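(* Let $n\ge 1$, $d\ge n$, and let $\boldsymbol{\Sigma}\in\mathbb{R}^{d\times d}$ be positive definite with eigenvalue vector $\boldsymbol{\lambda}=(\lambda_1,\dots,\lambda_d)$, $\lambda_1\ge\dots\ge\lambda_d>0$. Let $\boldsymbol{\Phi}_{\mathsf{train}}\in\mathbb{R}^{n\times d}$ have i.i.d. rows $\boldsymbol{\phi}(X_i)^\top$ with $\boldsymbol{\phi}(X_i)\sim\mathcal{N}(\mathbf{0},\boldsymbol{\Sigma})$. For a label vector $\mathbf{Y}_{\mathsf{train}}=(Y_1,\dots,Y_n)\in\{\pm1\}^n$, let $\widehat{\boldsymbol{\alpha}}_{\mathsf{SVM}}$ be the hard-margin SVM solution $$\widehat{\boldsymbol{\alpha}}_{\mathsf{SVM}}=\arg\min_{\boldsymbol{\alpha}\in\mathbb{R}^d}\|\boldsymbol{\alpha}\|_2\quad\text{s.t.}\quad Y_i\,\boldsymbol{\phi}(X_i)^\top\boldsymbol{\alpha}\ge 1\ \text{ for all } i=1,\dots,n.$$ Then: 1. If $$\|\boldsymbol{\lambda}\|_1\ \ge\ 72\left(\|\boldsymbol{\lambda}\|_2\cdot n\sqrt{\ln n}+\|\boldsymbol{\lambda}\|_\infty\cdot n\sqrt{n}\,\ln n+1\right),$$ then with probability at least $1-\frac{2}{n}$ (over the features), simultaneously for every $\mathbf{Y}_{\mathsf{train}}\in\{\pm1\}^n$ the corresponding vector $\widehat{\boldsymbol{\alpha}}_{\mathsf{SVM}}$ satisfies $\boldsymbol{\Phi}_{\mathsf{train}}\widehat{\boldsymbol{\alpha}}_{\mathsf{SVM}}=\mathbf{Y}_{\mathsf{train}}$.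 2. If $\boldsymbol{\Sigma}=\mathbf{I}_d$ and $d>10\,n\ln n+n-1$, then for any fixed $\mathbf{Y}_{\mathsf{train}}\in\{\pm1\}^n$ (independent of the features), with probability at least $1-\frac{2}{n}$ the vector $\widehat{\boldsymbol{\alpha}}_{\mathsf{SVM}}$ satisfies $\boldsymbol{\Phi}_{\mathsf{train}}\widehat{\boldsymbol{\alpha}}_{\mathsf{SVM}}=\mathbf{Y}_{\mathsf{train}}$.
   Context: $\|\cdot\|_1,\|\cdot\|_2,\|\cdot\|_\infty$ are the usual vector norms applied to the eigenvalue vector $\boldsymbol{\lambda}$ of $\boldsymbol{\Sigma}$. *)

theory Defs
  imports "HOL-Analysis.Analysis" "HOL-Probability.Probability"
begin

definition pos_def_mat :: "real^'d^'d \<Rightarrow> bool" where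
  "pos_def_mat S \<longleftrightarrow> transpose S = S \<and> (\<forall>x. x \<noteq> 0 \<longrightarrow> x \<bullet> (S *v x) > 0)"

definition diag_mat :: "real^'d \<Rightarrow> real^'d^'d" where
  "diag_mat v = (\<chi> i j. if i = j then v $ i else 0)"

definition eigenvalue_vector :: "real^'d^'d \<Rightarrow> real^'d \<Rightarrow> bool" where
  "eigenvalue_vector S lam \<longleftrightarrow>
     (\<exists>U. orthogonal_matrix U \<and> S = U ** diag_mat lam ** transpose U)"

definition norm1 :: "real^'d \<Rightarrow> real" where
  "norm1 v = (\<Sum>i\<in>UNIV. \<bar>v $ i\<bar>)"

definition norm2 :: "real^'d \<Rightarrow> real" where
  "norm2 v = sqrt (\<Sum>i\<in>UNIV. (v $ i)^2)"

definition norm_inf :: "real^'d \<Rightarrow> real" where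
  "norm_inf v = Max (range (\<lambda>i. \<bar>v $ i\<bar>))"

definition mvnormal :: "real^'d^'d \<Rightarrow> (real^'d) measure" where
  "mvnormal S = density lborel
     (\<lambda>x. ennreal (exp (- (x \<bullet> (matrix_inv S *v x)) / 2)
                   / sqrt ((2 * pi) ^ CARD('d) * det S)))"

definition feature_space :: "real^'d^'d \<Rightarrow> ('n::finite \<Rightarrow> real^'d) measure" where
  "feature_space S = PiM (UNIV :: 'n set) (\<lambda>_. mvnormal S)"

definition feature_matrix :: "('n::finite \<Rightarrow> real^'d) \<Rightarrow> real^'d^'n" where
  "feature_matrix \<omega> = (\<chi> i. \<omega> i)"

definition sign_labels :: "real^'n \<Rightarrow> bool" where
  "sign_labels Y \<longleftrightarrow> (\<forall>i. Y $ i = 1 \<or> Y $ i = -1)"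

definition svm_feasible :: "real^'d^'n \<Rightarrow> real^'n \<Rightarrow> real^'d \<Rightarrow> bool" where
  "svm_feasible Phi Y a \<longleftrightarrow> (\<forall>i. Y $ i * (Phi *v a) $ i \<ge> 1)"

definition svm_solution :: "real^'d^'n \<Rightarrow> real^'n \<Rightarrow> real^'d \<Rightarrow> bool" where
  "svm_solution Phi Y a \<longleftrightarrow> svm_feasible Phi Y a \<and>
     (\<forall>b. svm_feasible Phi Y b \<longrightarrow> norm a \<le> norm b)"

definition svm_interpolates :: "real^'d^'n \<Rightarrow> real^'n \<Rightarrow> bool" where
  "svm_interpolates Phi Y \<longleftrightarrow> (\<exists>a. svm_solution Phi Y a) \<and>
     (\<forall>a. svm_solution Phi Y a \<longrightarrow> Phi *v a = Y)"

end

theory Submission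
  imports Defs
begin

text \<open>
  By the KKT conditions the minimum-norm interpolator \<open>\<Phi>\<^sup>T K\<^sup>-\<^sup>1 Y\<close>, where \<open>K = \<Phi> \<Phi>\<^sup>T\<close>, solves the SVM as soon
  as \<open>Y\<^sub>i (K\<^sup>-\<^sup>1 Y)\<^sub>i \<ge> 0\<close> for all \<open>i\<close>.

  In the anisotropic case a Chernoff bound for each entry of \<open>K\<close> shows that \<open>K\<close> is so close to
  \<open>\<parallel>\<lambda>\<parallel>\<^sub>1 I\<close> in the row-sum norm that the sign pattern of \<open>K\<^sup>-\<^sup>1 Y\<close> is that of \<open>Y\<close>, for all \<open>Y\<close> at once.

  In the isotropic case a reflection of the rows fixes row \<open>i\<close> and moves \<open>Y\<close> into the plane of two
  coordinates \<open>i, j\<close>, without changing the law of \<open>\<Phi>\<close>. If \<open>P\<close> projects to the orthogonal complement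
  of the other rows, a wrong sign at \<open>i\<close> forces \<open>\<bar>P x\<^sub>j\<bar>\<^sup>2 \<le> \<plusminus> \<surd>(n-1) x\<^sub>i \<bullet> P x\<^sub>j\<close>. Integrating an exponential
  Markov bound over \<open>x\<^sub>i\<close> and then over \<open>x\<^sub>j\<close> bounds the probability by
  \<open>(1 - 1/n)\<close> to the power \<open>(d - n + 2)/2\<close>.
\<close>

section \<open>Dual certificates and Lebesgue measure\<close>

lemma inner_transpose_mult_vec:
  fixes A :: "real^'n^'m"
  shows "(transpose A *v x) \<bullet> y = x \<bullet> (A *v y)"
  by (simp add: dot_lmul_matrix)

text \<open>The vector \<open>a = transpose Phi *v \<beta>\<close> pairs with a feasible
  \<open>b\<close> through \<open>\<beta>\<close>: the nonnegative weights
  \<open>Y $ i * \<beta> $ i\<close> turn the margin constraints into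
  \<open>a \<bullet> a \<le> a \<bullet> b\<close>. Cauchy-Schwarz then gives minimality, and for
  another minimiser \<open>b\<close> the square of \<open>norm (b - a)\<close> is at most 0.
  Uniqueness matters because \<open>svm_interpolates\<close> speaks of every solution.\<close>

lemma svm_interpolates_of_dual:
  fixes Phi :: "real^'d^'n"
  assumes eq: "Phi *v (transpose Phi *v \<beta>) = Y"
    and Y: "sign_labels Y" and pos: "\<And>i. 0 \<le> Y $ i * \<beta> $ i"
  shows "svm_interpolates Phi Y"
proof -
  define a where "a = transpose Phi *v \<beta>"
  have a: "Phi *v a = Y" using eq by (simp add: a_def)
  have inner: "a \<bullet> b = \<beta> \<bullet> (Phi *v b)" for b
    by (simp only: a_def inner_transpose_mult_vec)
  have YY: "Y $ i * Y $ i = 1" for i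
    using Y by (auto simp: sign_labels_def) (metis mult_minus_left mult_1 minus_minus)+
  have feas: "svm_feasible Phi Y a"
    by (simp add: svm_feasible_def a YY)
  have key: "a \<bullet> a \<le> a \<bullet> b" if "svm_feasible Phi Y b" for b
  proof -
    have "\<beta> $ i * Y $ i \<le> \<beta> $ i * (Phi *v b) $ i" for i
    proof -
      have "Y $ i * \<beta> $ i * 1 \<le> Y $ i * \<beta> $ i * (Y $ i * (Phi *v b) $ i)"
        using that pos by (intro mult_left_mono) (auto simp: svm_feasible_def)
      also have "\<dots> = (Y $ i * Y $ i) * (\<beta> $ i * (Phi *v b) $ i)" by (simp add: algebra_simps)
      finally show ?thesis by (simp add: YY mult.commute)
    qed
    then show ?thesis by (simp add: inner a) (simp add: inner_vec_def sum_mono)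
  qed
  have le: "norm a \<le> norm b" if "svm_feasible Phi Y b" for b
  proof (cases "a = 0")
    case False
    have "norm a * norm a \<le> norm a * norm b"
      using key[OF that] norm_cauchy_schwarz[of a b] by (simp add: dot_square_norm power2_eq_square)
    with False show ?thesis by simp
  qed simp
  have unique: "b = a" if b: "svm_solution Phi Y b" for b
  proof -
    have "norm b \<le> norm a" "svm_feasible Phi Y b"
      using b feas by (auto simp: svm_solution_def)
    then have "b \<bullet> b \<le> a \<bullet> a" "a \<bullet> a \<le> a \<bullet> b"
      using key by (auto simp: norm_le)
    then have "(b - a) \<bullet> (b - a) \<le> 0"
      by (simp add: inner_diff_left inner_diff_right inner_commute)
    then have "b - a = 0" by (metis inner_eq_zero_iff inner_ge_zero order_antisym)
    then show ?thesis by simp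
  qed
  show ?thesis
    unfolding svm_interpolates_def using feas le unique a
    by (metis svm_solution_def)
qed

lemma surj_matrix_of_inj:
  fixes K :: "real^'n^'n"
  assumes "\<And>w. K *v w = 0 \<Longrightarrow> w = 0"
  shows "\<exists>\<beta>. K *v \<beta> = Y"
proof -
  have "inj ((*v) K)"
    using assms by (simp add: linear_injective_0)
  then have "surj ((*v) K)"
    by (simp add: linear_injective_imp_surjective)
  then show ?thesis by (metis surjD)
qed

text \<open>Write \<open>K\<close> as \<open>D\<close> times the identity plus an error of row-sum
  norm at most \<open>D / 2\<close>, and control the error by the largest coordinate of
  \<open>\<beta>\<close>. Then \<open>D * \<beta> $ i\<close> differs from \<open>Y $ i\<close> by
  at most 1, the modulus of a label, so no sign can flip.\<close>

lemma sign_pattern_of_near_scalar: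
  fixes K :: "real^'n^'n"
  assumes D: "D > 0"
    and row: "\<And>i. (\<Sum>j\<in>UNIV. \<bar>K $ i $ j - (if i = j then D else 0)\<bar>) \<le> D / 2"
    and Y: "sign_labels Y"
  shows "\<exists>\<beta>. K *v \<beta> = Y \<and> (\<forall>i. 0 \<le> Y $ i * \<beta> $ i)"
proof -
  have near: "\<bar>(K *v \<beta>) $ i - D * \<beta> $ i\<bar> \<le> D / 2 * M" if M: "\<And>j. \<bar>\<beta> $ j\<bar> \<le> M" for \<beta> i M
  proof -
    have "(K *v \<beta>) $ i - D * \<beta> $ i = (\<Sum>j\<in>UNIV. (K $ i $ j - (if i = j then D else 0)) * \<beta> $ j)"
      by (simp add: matrix_vector_mult_def left_diff_distrib sum_subtractf if_distrib[where f="\<lambda>x. x * _"]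
          cong: if_cong)
    also have "\<bar>\<dots>\<bar> \<le> (\<Sum>j\<in>UNIV. \<bar>K $ i $ j - (if i = j then D else 0)\<bar> * M)"
      by (rule order_trans[OF sum_abs]) (auto simp: abs_mult intro!: sum_mono mult_left_mono M)
    also have "\<dots> \<le> D / 2 * M"
      unfolding sum_distrib_right[symmetric]
      using M[of i] by (intro mult_right_mono row) linarith
    finally show ?thesis .
  qed
  have Max: "\<exists>k. \<forall>j. \<bar>\<beta> $ j\<bar> \<le> \<bar>\<beta> $ k\<bar>" for \<beta> :: "real^'n"
  proof -
    have "Max (range (\<lambda>j. \<bar>\<beta> $ j\<bar>)) \<in> range (\<lambda>j. \<bar>\<beta> $ j\<bar>)" by (intro Max_in) auto
    then obtain k where "Max (range (\<lambda>j. \<bar>\<beta> $ j\<bar>)) = \<bar>\<beta> $ k\<bar>" by (rule imageE)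
    moreover have "\<bar>\<beta> $ j\<bar> \<le> Max (range (\<lambda>j. \<bar>\<beta> $ j\<bar>))" for j by (rule Max_ge) auto
    ultimately show ?thesis by metis
  qed
  \<comment> \<open>The same estimate with right-hand side 0 makes \<open>K\<close> injective: the
    largest coordinate of \<open>w\<close> is at most half of itself in modulus.\<close>
  have "w = 0" if w: "K *v w = 0" for w
  proof -
    obtain k where k: "\<And>j. \<bar>w $ j\<bar> \<le> \<bar>w $ k\<bar>" using Max by blast
    have "D * \<bar>w $ k\<bar> \<le> D / 2 * \<bar>w $ k\<bar>"
      using near[OF k, of k] w D by (simp add: abs_mult)
    then have "w $ k = 0" using D by simp
    then show ?thesis using k by (simp add: vec_eq_iff)
  qed
  then obtain \<beta> where \<beta>: "K *v \<beta> = Y" using surj_matrix_of_inj by blast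
  obtain k where k: "\<And>j. \<bar>\<beta> $ j\<bar> \<le> \<bar>\<beta> $ k\<bar>" using Max by blast
  have Y1: "\<bar>Y $ i\<bar> = 1" for i using Y by (metis sign_labels_def abs_minus abs_1)
  have n: "\<bar>Y $ i - D * \<beta> $ i\<bar> \<le> D / 2 * \<bar>\<beta> $ k\<bar>" for i
    using near[OF k, of i] \<beta> by simp
  \<comment> \<open>At the largest coordinate, \<open>D * \<bar>\<beta> $ k\<bar>\<close> is at most
    1 plus half of itself.\<close>
  have "D * \<bar>\<beta> $ k\<bar> \<le> 2"
  proof -
    have "\<bar>D * \<beta> $ k\<bar> = D * \<bar>\<beta> $ k\<bar>" using D by (simp add: abs_mult)
    then show ?thesis using n[of k] Y1[of k] by linarith
  qed
  then have "\<bar>Y $ i - D * \<beta> $ i\<bar> \<le> 1" for i using n[of i] by simp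
  then have "0 \<le> Y $ i * (D * \<beta> $ i)" for i
    using Y[unfolded sign_labels_def, rule_format, of i] by (auto simp: abs_le_iff)
       (smt (verit))+
  then have "0 \<le> Y $ i * \<beta> $ i" for i
    using D by (metis mult.left_commute zero_le_mult_iff not_less)
  with \<beta> show ?thesis by blast
qed

section \<open>Invariance and product structure of Lebesgue measure\<close>

lemma nn_integral_lborel_translate:
  fixes h :: "'a::euclidean_space \<Rightarrow> ennreal"
  assumes [measurable]: "h \<in> borel_measurable borel"
  shows "(\<integral>\<^sup>+y. h (c + y) \<partial>lborel) = (\<integral>\<^sup>+y. h y \<partial>lborel)"
  by (subst (2) lborel_distr_plus[of c, symmetric]) (simp add: nn_integral_distr)

text \<open>Uniqueness of translation-invariant measures: exchange the integrals of the unit ball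
  and of \<open>A\<close> after a shift that couples the two variables.\<close>

lemma lborel_distr_orthogonal:
  fixes f :: "'a::euclidean_space \<Rightarrow> 'a"
  assumes f: "orthogonal_transformation f"
  shows "distr lborel borel f = lborel"
proof (rule measure_eqI)
  fix A assume "A \<in> sets (distr lborel borel f)"
  then have A[measurable]: "A \<in> sets borel" by simp
  define g where "g = inv f"
  have fg: "f (g x) = x" for x
    using orthogonal_transformation_surj[OF f] by (simp add: g_def surj_f_inv_f)
  have lin: "linear f" by (rule orthogonal_transformation_linear[OF f])
  have fm[measurable]: "f \<in> borel_measurable borel"
    using lin by (intro borel_measurable_continuous_onI) (simp add: linear_continuous_on linear_conv_bounded_linear)
  let ?B = "ball (0::'a) 1"
  have B: "emeasure lborel (ball c 1) = emeasure lborel ?B" for c :: 'a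
  proof -
    have "(indicator (ball c 1) :: 'a \<Rightarrow> ennreal) \<in> borel_measurable borel"
      by (rule borel_measurable_indicator) simp
    then have "emeasure lborel (ball c 1) = (\<integral>\<^sup>+y. indicator (ball c 1) (c + y) \<partial>lborel)"
      by (simp add: nn_integral_lborel_translate)
    also have "\<dots> = (\<integral>\<^sup>+y. indicator ?B y \<partial>lborel)"
      by (intro nn_integral_cong) (auto simp: dist_norm indicator_def)
    finally show ?thesis by simp
  qed
  define IA where "IA = (indicator A :: 'a \<Rightarrow> ennreal)"
  define IB where "IB = (indicator ?B :: 'a \<Rightarrow> ennreal)"
  have IA[measurable]: "IA \<in> borel_measurable borel" by (simp add: IA_def)
  have IB[measurable]: "IB \<in> borel_measurable borel"
    unfolding IB_def by (rule borel_measurable_indicator) simp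
  have "emeasure lborel ?B * emeasure lborel (f -` A) =
      (\<integral>\<^sup>+x. IB x * (\<integral>\<^sup>+y. IA (f y) \<partial>lborel) \<partial>lborel)"
  proof -
    have "f -` A \<in> sets borel" using measurable_sets[OF fm A] by simp
    then have "emeasure lborel (f -` A) = (\<integral>\<^sup>+y. indicator (f -` A) y \<partial>lborel)" by simp
    also have "(\<lambda>y. indicator (f -` A) y :: ennreal) = (\<lambda>y. IA (f y))"
      by (auto simp: indicator_def IA_def)
    finally have "emeasure lborel (f -` A) = (\<integral>\<^sup>+y. IA (f y) \<partial>lborel)" .
    moreover have "emeasure lborel ?B = (\<integral>\<^sup>+x. IB x \<partial>lborel)" by (simp add: IB_def)
    ultimately show ?thesis by (simp add: nn_integral_multc)
  qed
  \<comment> \<open>Shifting the inner variable by \<open>g x\<close>, the preimage of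
    \<open>x\<close>, turns the argument of \<open>IA\<close> into \<open>x + f y\<close>; this is
    the coupling of the two variables.\<close>
  also have "\<dots> = (\<integral>\<^sup>+x. (\<integral>\<^sup>+y. IB x * IA (f (g x + y)) \<partial>lborel) \<partial>lborel)"
    by (subst nn_integral_cmult)
      (simp_all add: nn_integral_lborel_translate[where h="\<lambda>y. IA (f y)"])
  also have "\<dots> = (\<integral>\<^sup>+x. (\<integral>\<^sup>+y. IB x * IA (x + f y) \<partial>lborel) \<partial>lborel)"
    by (simp add: linear_add[OF lin] fg)
  also have "\<dots> = (\<integral>\<^sup>+y. (\<integral>\<^sup>+x. IB x * IA (x + f y) \<partial>lborel) \<partial>lborel)"
    by (intro lborel_pair.Fubini') measurable
  \<comment> \<open>A translation by \<open>f y\<close> in \<open>x\<close> moves the coupling from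
    \<open>A\<close> to the ball.\<close>
  also have "\<dots> = (\<integral>\<^sup>+y. (\<integral>\<^sup>+x. IB (x - f y) * IA x \<partial>lborel) \<partial>lborel)"
  proof (rule nn_integral_cong)
    fix y
    show "(\<integral>\<^sup>+x. IB x * IA (x + f y) \<partial>lborel)
        = (\<integral>\<^sup>+x. IB (x - f y) * IA x \<partial>lborel)"
      by (subst nn_integral_lborel_translate[where c="f y", symmetric]) (simp_all add: add.commute)
  qed
  also have "\<dots> = (\<integral>\<^sup>+x. (\<integral>\<^sup>+y. IB (x - f y) * IA x \<partial>lborel) \<partial>lborel)"
    by (intro lborel_pair.Fubini') measurable
  also have "\<dots> = (\<integral>\<^sup>+x. emeasure lborel ?B * IA x \<partial>lborel)"
  proof (rule nn_integral_cong)
    fix x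
    \<comment> \<open>Orthogonality enters here: as a condition on \<open>y\<close>, membership in
      the ball is again membership in a unit ball, now centred at \<open>g x\<close>.\<close>
    have "norm (x - f y) = dist (g x) y" for y
      using orthogonal_transformation_norm[OF f, of "g x - y"]
      by (simp add: linear_diff[OF lin] fg dist_norm)
    then have IB_eq: "IB (x - f y) = indicator (ball (g x) 1) y" for y
      by (simp add: indicator_def IB_def)
    have "(\<integral>\<^sup>+y. IB (x - f y) * IA x \<partial>lborel)
       = (\<integral>\<^sup>+y. indicator (ball (g x) 1) y * IA x \<partial>lborel)"
      by (simp only: IB_eq)
    also have "\<dots> = (\<integral>\<^sup>+y. indicator (ball (g x) 1) y \<partial>lborel) * IA x"
      by (rule nn_integral_multc) (rule borel_measurable_indicator, simp)
    also have "\<dots> = emeasure lborel ?B * IA x"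
      by (simp add: B[of "g x"])
    finally show "(\<integral>\<^sup>+y. IB (x - f y) * IA x \<partial>lborel) = emeasure lborel ?B * IA x" .
  qed
  also have "\<dots> = emeasure lborel ?B * emeasure lborel A"
    by (simp add: nn_integral_cmult IA_def)
  finally have eq: "emeasure lborel ?B * emeasure lborel (f -` A) = emeasure lborel ?B * emeasure lborel A" .
  have "emeasure lborel ?B \<noteq> 0"
    using content_ball_pos[of 1 "0::'a"] by (auto simp: measure_def)
  moreover have "emeasure lborel ?B \<noteq> \<infinity>"
    using emeasure_lborel_ball_finite[of "0::'a" 1] by auto
  ultimately have "emeasure lborel (f -` A) = emeasure lborel A"
    using eq by (simp add: ennreal_mult_cancel_left)
  then show "emeasure (distr lborel borel f) A = emeasure lborel A"
    by (simp add: emeasure_distr)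
qed simp

lemma borel_measurable_vec_lambda:
  "(\<lambda>\<omega>. \<chi> i. \<omega> i) \<in> PiM (UNIV :: 'n::finite set) (\<lambda>_. borel :: ('a::euclidean_space) measure) \<rightarrow>\<^sub>M borel"
proof -
  have "(\<lambda>\<omega>::'n \<Rightarrow> 'a. \<chi> i. \<omega> i) \<in> borel_measurable borel"
    by (intro borel_measurable_continuous_onI continuous_intros) auto
  then show ?thesis
    by (simp only: measurable_cong_sets[OF sets_PiM_equal_borel refl])
qed

text \<open>Lebesgue measure is determined by the volumes of boxes, and a box of
  \<open>'a^'n\<close> is a product of boxes of \<open>'a\<close>. This serves both to split a
  vector into coordinates and to assemble independent rows into a matrix.\<close>

lemma distr_PiM_lborel_vec:
  "distr (PiM (UNIV :: 'n::finite set) (\<lambda>_. lborel :: ('a::euclidean_space) measure)) borel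
    (\<lambda>\<omega>. \<chi> i. \<omega> i) = lborel"
proof (rule lborel_eqI[symmetric])
  interpret product_sigma_finite "\<lambda>_::'n. lborel :: 'a measure" ..
  have m: "(\<lambda>\<omega>. \<chi> i. \<omega> i) \<in> PiM (UNIV :: 'n set) (\<lambda>_. lborel :: 'a measure) \<rightarrow>\<^sub>M borel"
    using borel_measurable_vec_lambda
    by (simp only: measurable_cong_sets[OF sets_PiM_cong[OF refl sets_lborel] refl])
  fix l u :: "'a^'n"
  assume lu: "\<And>b. b \<in> Basis \<Longrightarrow> l \<bullet> b \<le> u \<bullet> b"
  have lu': "l $ i \<bullet> b \<le> u $ i \<bullet> b" if "b \<in> Basis" for i b
    using lu[of "axis i b"] that by (simp add: inner_axis)
  have "(\<lambda>\<omega>. \<chi> i. \<omega> i) -` box l u = Pi\<^sub>E UNIV (\<lambda>i. box (l $ i) (u $ i))"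
    by (auto simp: box_def Basis_vec_def inner_axis)
  then have "emeasure (distr (PiM UNIV (\<lambda>_. lborel)) borel (\<lambda>\<omega>. \<chi> i. \<omega> i)) (box l u)
     = emeasure (PiM UNIV (\<lambda>_. lborel)) (Pi\<^sub>E UNIV (\<lambda>i. box (l $ i) (u $ i)))"
    by (simp add: emeasure_distr m space_PiM)
  also have "\<dots> = (\<Prod>i\<in>UNIV. emeasure lborel (box (l $ i) (u $ i)))"
    by (rule emeasure_PiM) auto
  also have "\<dots> = ennreal (\<Prod>i\<in>UNIV. \<Prod>b\<in>Basis. (u $ i - l $ i) \<bullet> b)"
    by (simp add: lu' emeasure_lborel_box_eq prod_ennreal prod_nonneg inner_diff_left)
  also have "(\<Prod>i\<in>UNIV. \<Prod>b\<in>Basis. (u $ i - l $ i) \<bullet> b) = (\<Prod>(i,b)\<in>UNIV \<times> Basis. (u - l) \<bullet> axis i b)"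
    by (simp add: prod.cartesian_product inner_axis)
  also have "\<dots> = (\<Prod>b\<in>Basis. (u - l) \<bullet> b)"
    by (rule prod.reindex_cong[of "\<lambda>(i,b). axis i b" "UNIV \<times> Basis", symmetric])
      (auto simp: inj_on_def axis_eq_axis Basis_vec_def)
  finally show "emeasure (distr (PiM (UNIV :: 'n set) (\<lambda>_. lborel)) borel (\<lambda>\<omega>. \<chi> i. \<omega> i)) (box l u)
     = ennreal (\<Prod>b\<in>Basis. (u - l) \<bullet> b)" .
qed simp

section \<open>Gaussian integrals\<close>

lemma nn_integral_lborel_vec_prod:
  fixes g :: "'d::finite \<Rightarrow> real \<Rightarrow> ennreal"
  assumes [measurable]: "\<And>k. g k \<in> borel_measurable borel"
  shows "(\<integral>\<^sup>+x. (\<Prod>k\<in>UNIV. g k (x $ k)) \<partial>lborel) = (\<Prod>k\<in>UNIV. \<integral>\<^sup>+t. g k t \<partial>lborel)"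
proof -
  interpret product_sigma_finite "\<lambda>_::'d. lborel :: real measure" ..
  have m: "(\<lambda>w. \<chi> i. w i) \<in> PiM (UNIV :: 'd set) (\<lambda>_. lborel :: real measure) \<rightarrow>\<^sub>M borel"
    using borel_measurable_vec_lambda
    by (simp only: measurable_cong_sets[OF sets_PiM_cong[OF refl sets_lborel] refl])
  have [measurable]: "(\<lambda>x::real^'d. x $ k) \<in> borel_measurable borel" for k
    by (intro borel_measurable_continuous_onI continuous_intros)
  show ?thesis
    by (subst distr_PiM_lborel_vec[symmetric], subst nn_integral_distr[OF m])
      (simp_all add: product_nn_integral_prod)
qed

lemma nn_integral_lborel_orthogonal:
  fixes F :: "'a::euclidean_space \<Rightarrow> ennreal"
  assumes f: "orthogonal_transformation (f :: 'a \<Rightarrow> 'a)" and F: "F \<in> borel_measurable borel"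
  shows "(\<integral>\<^sup>+x. F (f x) \<partial>lborel) = (\<integral>\<^sup>+x. F x \<partial>lborel)"
proof -
  have "f \<in> borel_measurable borel"
    using orthogonal_transformation_linear[OF f]
    by (intro borel_measurable_continuous_onI) (simp add: linear_continuous_on linear_conv_bounded_linear)
  then show ?thesis
    by (subst (2) lborel_distr_orthogonal[OF f, symmetric]) (simp add: nn_integral_distr F)
qed

section \<open>Algebra of orthogonally diagonalised matrices\<close>

lemma diag_mat_mult_vec: "(diag_mat v *v x) $ k = v $ k * x $ k"
  by (simp add: diag_mat_def matrix_vector_mult_def if_distrib[where f="\<lambda>x. x * _"] cong: if_cong)

lemma diag_mat_mult: "diag_mat v ** diag_mat w = diag_mat (\<chi> k. v $ k * w $ k)"
  by (simp add: matrix_eq vec_eq_iff diag_mat_mult_vec flip: matrix_vector_mul_assoc)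

lemma diag_mat_one: "diag_mat (\<chi> k. 1) = mat 1"
  by (simp add: matrix_eq vec_eq_iff diag_mat_mult_vec)

lemma quadratic_form_orthogonal_diag:
  fixes U :: "real^'d^'d"
  shows "x \<bullet> ((U ** diag_mat v ** transpose U) *v x) = (\<Sum>k\<in>UNIV. v $ k * ((transpose U *v x) $ k)\<^sup>2)"
proof -
  have "x \<bullet> ((U ** diag_mat v ** transpose U) *v x)
      = (transpose U *v x) \<bullet> (diag_mat v *v (transpose U *v x))"
    by (simp only: inner_transpose_mult_vec matrix_vector_mul_assoc matrix_mul_assoc)
  also have "\<dots> = (\<Sum>k\<in>UNIV. v $ k * ((transpose U *v x) $ k)\<^sup>2)"
    unfolding inner_vec_def diag_mat_mult_vec
    by (intro sum.cong) (simp_all add: power2_eq_square)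
  finally show ?thesis .
qed

lemma matrix_inv_orthogonal_diag:
  fixes U :: "real^'d^'d"
  assumes U: "orthogonal_matrix U" and v: "\<And>k. v $ k \<noteq> 0"
  shows "matrix_inv (U ** diag_mat v ** transpose U) = U ** diag_mat (\<chi> k. 1 / v $ k) ** transpose U"
proof -
  let ?S = "U ** diag_mat v ** transpose U" and ?T = "U ** diag_mat (\<chi> k. 1 / v $ k) ** transpose U"
  have UU: "transpose U ** U = mat 1" "U ** transpose U = mat 1"
    using U by (auto simp: orthogonal_matrix_def)
  have "?S ** ?T = U ** (diag_mat v ** (transpose U ** U) ** diag_mat (\<chi> k. 1 / v $ k)) ** transpose U"
    by (simp add: matrix_mul_assoc)
  also have "\<dots> = mat 1"
    using v by (simp add: UU diag_mat_mult diag_mat_one)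
  finally have ST: "?S ** ?T = mat 1" .
  then have "invertible ?S"
    by (meson invertible_right_inverse)
  \<comment> \<open>\<open>matrix_inv\<close> is a chosen inverse, so its equations come from the
    existence of some inverse; the explicit right inverse \<open>?T\<close> then identifies
    it.\<close>
  then have "matrix_inv ?S ** ?S = mat 1"
    unfolding matrix_inv_def invertible_def by (rule someI2_ex) simp
  then have "?T = matrix_inv ?S ** ?S ** ?T"
    by simp
  also have "\<dots> = matrix_inv ?S ** (?S ** ?T)" by (simp only: matrix_mul_assoc)
  finally show ?thesis unfolding ST by simp
qed

lemma det_orthogonal_diag:
  fixes U :: "real^'d^'d"
  assumes U: "orthogonal_matrix U"
  shows "det (U ** diag_mat v ** transpose U) = (\<Prod>k\<in>UNIV. v $ k)"
proof -
  have "det U * det U = 1" using det_orthogonal_matrix[OF U] by auto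
  moreover have "det (diag_mat v) = (\<Prod>k\<in>UNIV. v $ k)"
    by (subst det_diagonal) (auto simp: diag_mat_def)
  ultimately show ?thesis
    by (simp add: det_mul)
qed

lemma sqrt_prod: "sqrt (prod f A) = (\<Prod>x\<in>A. sqrt (f x))"
  by (induction A rule: infinite_finite_induct) (auto simp: real_sqrt_mult)

section \<open>Integrals against the multivariate normal law\<close>

lemma borel_measurable_mvnormal_density:
  fixes S :: "real^'d^'d"
  shows "(\<lambda>x. ennreal (exp (- (x \<bullet> (matrix_inv S *v x)) / 2) / sqrt ((2 * pi) ^ CARD('d) * det S)))
    \<in> borel_measurable borel"
proof -
  have [measurable]: "(\<lambda>x. A *v x) \<in> borel_measurable borel" for A :: "real^'d^'d"
    by (intro borel_measurable_continuous_onI) (simp add: matrix_vector_mult_linear_continuous_on)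
  show ?thesis by measurable
qed

lemma AE_mvnormal: "AE x in lborel. P x \<Longrightarrow> AE x in mvnormal S. P x"
  using borel_measurable_mvnormal_density[of S]
  unfolding mvnormal_def by (subst AE_density) auto

text \<open>In the coordinates \<open>transpose U *v x\<close> the quadratic form is diagonal and
  the determinant is the product of the eigenvalues, so the density factors into centred normal
  densities of variance \<open>lam $ k\<close>. The total mass and the exponential moments below are
  choices of \<open>h\<close>.\<close>

lemma nn_integral_mvnormal_prod:
  fixes U S :: "real^'d^'d" and h :: "'d \<Rightarrow> real \<Rightarrow> ennreal"
  assumes U: "orthogonal_matrix U" and S: "S = U ** diag_mat lam ** transpose U"
    and pos: "\<And>k. lam $ k > 0"
    and h[measurable]: "\<And>k. h k \<in> borel_measurable borel"
  shows "(\<integral>\<^sup>+x. (\<Prod>k\<in>UNIV. h k ((transpose U *v x) $ k)) \<partial>mvnormal S)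
    = (\<Prod>k\<in>UNIV. \<integral>\<^sup>+t. ennreal (normal_density 0 (sqrt (lam $ k)) t) * h k t \<partial>lborel)"
proof -
  have nth[measurable]: "(\<lambda>x::real^'d. x $ k) \<in> borel_measurable borel" for k
    by (intro borel_measurable_continuous_onI continuous_intros)
  have mat[measurable]: "(\<lambda>x. A *v x) \<in> borel_measurable borel" for A :: "real^'d^'d"
    by (intro borel_measurable_continuous_onI) (simp add: matrix_vector_mult_linear_continuous_on)
  have ot: "orthogonal_transformation ((*v) U)"
    using U by (simp add: orthogonal_transformation_matrix)
  have UU: "transpose U *v (U *v y) = y" for y
    using U by (simp add: matrix_vector_mul_assoc orthogonal_matrix_def)
  define den where "den = (\<lambda>x. ennreal (exp (- (x \<bullet> (matrix_inv S *v x)) / 2) / sqrt ((2 * pi) ^ CARD('d) * det S)))"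
  have [measurable]: "den \<in> borel_measurable borel"
    unfolding den_def by (rule borel_measurable_mvnormal_density)
  have den: "den (U *v y) = (\<Prod>k\<in>UNIV. ennreal (normal_density 0 (sqrt (lam $ k)) (y $ k)))" for y
  proof -
    have "(U *v y) \<bullet> (matrix_inv S *v (U *v y)) = (\<Sum>k\<in>UNIV. (y $ k)\<^sup>2 / lam $ k)"
      unfolding S matrix_inv_orthogonal_diag[OF U less_imp_neq[OF pos, THEN not_sym]]
        quadratic_form_orthogonal_diag UU
      by simp
    moreover have "sqrt ((2 * pi) ^ CARD('d) * det S) = (\<Prod>k\<in>UNIV. sqrt (2 * pi * lam $ k))"
      by (simp add: S det_orthogonal_diag[OF U] prod.distrib flip: sqrt_prod)
    ultimately have "exp (- ((U *v y) \<bullet> (matrix_inv S *v (U *v y))) / 2) / sqrt ((2 * pi) ^ CARD('d) * det S)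
      = (\<Prod>k\<in>UNIV. exp (- (y $ k)\<^sup>2 / (2 * lam $ k)) / sqrt (2 * pi * lam $ k))"
      by (simp add: prod_dividef exp_sum[symmetric] sum_negf sum_divide_distrib mult.commute)
    then show ?thesis
      using pos by (simp add: den_def normal_density_def less_imp_le prod_ennreal)
  qed
  have "(\<integral>\<^sup>+x. (\<Prod>k\<in>UNIV. h k ((transpose U *v x) $ k)) \<partial>mvnormal S)
     = (\<integral>\<^sup>+x. den x * (\<Prod>k\<in>UNIV. h k ((transpose U *v x) $ k)) \<partial>lborel)"
    unfolding mvnormal_def den_def[symmetric] by (rule nn_integral_density) measurable
  \<comment> \<open>Substituting \<open>U *v y\<close> for \<open>x\<close> preserves Lebesgue
    measure since \<open>U\<close> is orthogonal.\<close>
  also have "\<dots> = (\<integral>\<^sup>+y. den (U *v y) * (\<Prod>k\<in>UNIV. h k ((transpose U *v (U *v y)) $ k)) \<partial>lborel)"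
    by (rule nn_integral_lborel_orthogonal[OF ot, symmetric]) measurable
  also have "\<dots> = (\<integral>\<^sup>+y. (\<Prod>k\<in>UNIV. ennreal (normal_density 0 (sqrt (lam $ k)) (y $ k)) * h k (y $ k)) \<partial>lborel)"
    by (simp only: den UU prod.distrib)
  also have "\<dots> = (\<Prod>k\<in>UNIV. \<integral>\<^sup>+t. ennreal (normal_density 0 (sqrt (lam $ k)) t) * h k t \<partial>lborel)"
    by (rule nn_integral_lborel_vec_prod) measurable
  finally show ?thesis .
qed

lemma nn_integral_normal_density:
  "\<sigma> > 0 \<Longrightarrow> (\<integral>\<^sup>+t. ennreal (normal_density \<mu> \<sigma> t) \<partial>lborel) = 1"
  by (subst nn_integral_eq_integral) auto

text \<open>Completing the square: the tilted density is a multiple of the normal density with mean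
  \<open>b * lam\<close> and unchanged variance.\<close>

lemma nn_integral_normal_exp_linear:
  assumes "lam > 0"
  shows "(\<integral>\<^sup>+t. ennreal (normal_density 0 (sqrt lam) t) * ennreal (exp (b * t)) \<partial>lborel) = ennreal (exp (b\<^sup>2 * lam / 2))"
proof -
  have "normal_density 0 (sqrt lam) t * exp (b * t)
      = exp (b\<^sup>2 * lam / 2) * normal_density (b * lam) (sqrt lam) t" for t
  proof -
    have "- t\<^sup>2 / (2 * lam) + b * t = b\<^sup>2 * lam / 2 + - (t - b * lam)\<^sup>2 / (2 * lam)"
      using assms by (simp add: field_simps power2_eq_square)
    then show ?thesis
      using assms by (simp add: normal_density_def less_imp_le flip: exp_add)
  qed
  then have "ennreal (normal_density 0 (sqrt lam) t) * ennreal (exp (b * t))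
      = ennreal (exp (b\<^sup>2 * lam / 2)) * ennreal (normal_density (b * lam) (sqrt lam) t)" for t
    by (simp only: ennreal_mult[symmetric] exp_ge_zero normal_density_nonneg)
  then show ?thesis
    using assms by (simp add: nn_integral_cmult nn_integral_normal_density)
qed

text \<open>The tilted density is a multiple of the centred normal density with variance
  \<open>lam / (1 - 2 * \<mu> * lam)\<close>; the second assumption keeps that variance
  positive.\<close>

lemma nn_integral_normal_exp_square:
  assumes "lam > 0" "2 * \<mu> * lam < 1"
  shows "(\<integral>\<^sup>+t. ennreal (normal_density 0 (sqrt lam) t) * ennreal (exp (\<mu> * t\<^sup>2)) \<partial>lborel)
    = ennreal (1 / sqrt (1 - 2 * \<mu> * lam))"
proof -
  let ?c = "1 - 2 * \<mu> * lam"
  have c: "?c > 0" using assms by simp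
  have eq: "normal_density 0 (sqrt lam) t * exp (\<mu> * t\<^sup>2)
      = 1 / sqrt ?c * normal_density 0 (sqrt (lam / ?c)) t" for t
  proof -
    have "- t\<^sup>2 / (2 * lam) + \<mu> * t\<^sup>2 = - t\<^sup>2 / (2 * (lam / ?c))"
      using assms by (simp add: field_simps)
    moreover have "1 / sqrt (2 * pi * lam) = 1 / sqrt ?c * (1 / sqrt (2 * pi * (lam / ?c)))"
      using assms c by (simp add: real_sqrt_divide real_sqrt_mult)
    ultimately show ?thesis
      using assms c by (simp add: normal_density_def less_imp_le flip: exp_add)
  qed
  have "ennreal (normal_density 0 (sqrt lam) t) * ennreal (exp (\<mu> * t\<^sup>2))
      = ennreal (1 / sqrt ?c) * ennreal (normal_density 0 (sqrt (lam / ?c)) t)" for t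
  proof -
    have "0 \<le> 1 / sqrt ?c" using c by simp
    with eq[of t] show ?thesis
      by (simp only: ennreal_mult[symmetric] exp_ge_zero normal_density_nonneg)
  qed
  then show ?thesis
    using assms c by (simp add: nn_integral_cmult nn_integral_normal_density)
qed

lemma sets_mvnormal: "sets (mvnormal S) = sets borel"
  by (simp add: mvnormal_def)

lemma prob_space_mvnormal:
  fixes U S :: "real^'d^'d"
  assumes "orthogonal_matrix U" "S = U ** diag_mat lam ** transpose U" "\<And>k. lam $ k > 0"
  shows "prob_space (mvnormal S)"
proof
  have "emeasure (mvnormal S) (space (mvnormal S)) = (\<integral>\<^sup>+x. 1 \<partial>mvnormal S)" by simp
  also have "\<dots> = 1"
    using nn_integral_mvnormal_prod[OF assms, of "\<lambda>_ _. 1"] assms(3)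
    by (simp add: nn_integral_normal_density)
  finally show "emeasure (mvnormal S) (space (mvnormal S)) = 1" .
qed

lemma nn_integral_mvnormal_exp_inner:
  fixes U S :: "real^'d^'d"
  assumes U: "orthogonal_matrix U" and S: "S = U ** diag_mat lam ** transpose U"
    and pos: "\<And>k. lam $ k > 0"
  shows "(\<integral>\<^sup>+x. ennreal (exp (b \<bullet> x)) \<partial>mvnormal S) = ennreal (exp (b \<bullet> (S *v b) / 2))"
proof -
  have UU: "U ** transpose U = mat 1"
    using U by (auto simp: orthogonal_matrix_def)
  have "b \<bullet> x = (\<Sum>k\<in>UNIV. (transpose U *v b) $ k * (transpose U *v x) $ k)" for x
  proof -
    have "(transpose U *v b) \<bullet> (transpose U *v x) = b \<bullet> ((U ** transpose U) *v x)"
      by (simp only: inner_transpose_mult_vec matrix_vector_mul_assoc)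
    then show ?thesis unfolding UU by (simp add: inner_vec_def)
  qed
  then have "(\<integral>\<^sup>+x. ennreal (exp (b \<bullet> x)) \<partial>mvnormal S)
     = (\<integral>\<^sup>+x. (\<Prod>k\<in>UNIV. ennreal (exp ((transpose U *v b) $ k * (transpose U *v x) $ k))) \<partial>mvnormal S)"
    by (simp add: exp_sum prod_ennreal)
  also have "\<dots> = (\<Prod>k\<in>UNIV. ennreal (exp (((transpose U *v b) $ k)\<^sup>2 * lam $ k / 2)))"
    by (subst nn_integral_mvnormal_prod[OF U S pos])
      (simp_all add: nn_integral_normal_exp_linear pos)
  also have "\<dots> = ennreal (exp (b \<bullet> (S *v b) / 2))"
    by (simp add: S quadratic_form_orthogonal_diag exp_sum[symmetric] prod_ennreal sum_divide_distrib mult.commute)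
  finally show ?thesis .
qed

lemma nn_integral_mvnormal_exp_squares:
  fixes U S :: "real^'d^'d"
  assumes U: "orthogonal_matrix U" and S: "S = U ** diag_mat lam ** transpose U"
    and pos: "\<And>k. lam $ k > 0" and \<mu>: "\<And>k. 2 * \<mu> k * lam $ k < 1"
  shows "(\<integral>\<^sup>+x. ennreal (exp (\<Sum>k\<in>UNIV. \<mu> k * ((transpose U *v x) $ k)\<^sup>2)) \<partial>mvnormal S)
    = ennreal (\<Prod>k\<in>UNIV. 1 / sqrt (1 - 2 * \<mu> k * lam $ k))"
proof -
  have "(\<integral>\<^sup>+x. ennreal (exp (\<Sum>k\<in>UNIV. \<mu> k * ((transpose U *v x) $ k)\<^sup>2)) \<partial>mvnormal S)
     = (\<integral>\<^sup>+x. (\<Prod>k\<in>UNIV. ennreal (exp (\<mu> k * ((transpose U *v x) $ k)\<^sup>2))) \<partial>mvnormal S)"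
    by (simp add: exp_sum prod_ennreal)
  also have "\<dots> = (\<Prod>k\<in>UNIV. ennreal (1 / sqrt (1 - 2 * \<mu> k * lam $ k)))"
    by (subst nn_integral_mvnormal_prod[OF U S pos])
      (simp_all add: nn_integral_normal_exp_square pos \<mu>)
  also have "\<dots> = ennreal (\<Prod>k\<in>UNIV. 1 / sqrt (1 - 2 * \<mu> k * lam $ k))"
    using \<mu> by (intro prod_ennreal) (simp add: less_imp_le)
  finally show ?thesis .
qed

section \<open>Resampling one coordinate of a product measure\<close>

lemma measurable_resample:
  fixes f :: "('n::finite \<Rightarrow> 'a) \<Rightarrow> ennreal"
  assumes N: "prob_space N" and f[measurable]: "f \<in> borel_measurable (PiM UNIV (\<lambda>_. N))"
  shows "(\<lambda>w. \<integral>\<^sup>+y. f (w(i := y)) \<partial>N) \<in> borel_measurable (PiM UNIV (\<lambda>_. N))"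
proof -
  interpret N: prob_space N by fact
  have [measurable]: "(\<lambda>x. (fst x)(i := snd x)) \<in> PiM UNIV (\<lambda>_. N) \<Otimes>\<^sub>M N \<rightarrow>\<^sub>M PiM UNIV (\<lambda>_::'n. N)"
    by (rule measurable_fun_upd[of _ UNIV]) auto
  show ?thesis by measurable
qed

text \<open>This integrates out one coordinate while staying on the full product space. The inner
  integral on the right overwrites coordinate \<open>i\<close>, so the outer integral averages a
  constant over that coordinate against a probability measure, and both sides reduce to an integral
  over the remaining ones.\<close>

lemma nn_integral_PiM_resample:
  fixes N :: "'a measure" and f :: "('n::finite \<Rightarrow> 'a) \<Rightarrow> ennreal"
  assumes N: "prob_space N" and f[measurable]: "f \<in> borel_measurable (PiM UNIV (\<lambda>_. N))"
  shows "(\<integral>\<^sup>+w. f w \<partial>PiM UNIV (\<lambda>_. N)) = (\<integral>\<^sup>+w. (\<integral>\<^sup>+y. f (w(i := y)) \<partial>N) \<partial>PiM UNIV (\<lambda>_. N))"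
proof -
  interpret N: prob_space N by fact
  interpret product_sigma_finite "\<lambda>_::'n. N" ..
  let ?J = "UNIV - {i}"
  have U: "insert i ?J = UNIV" by auto
  have f': "f \<in> borel_measurable (PiM (insert i ?J) (\<lambda>_. N))" unfolding U by (rule f)
  have "(\<lambda>w. \<integral>\<^sup>+y. f (w(i := y)) \<partial>N) \<in> borel_measurable (PiM (insert i ?J) (\<lambda>_. N))"
    unfolding U by (rule measurable_resample[OF N f])
  from product_nn_integral_insert[OF _ _ this] product_nn_integral_insert[OF _ _ f']
  show ?thesis
    unfolding U by (simp add: N.emeasure_space_1)
qed

section \<open>Chernoff bounds for Gram entries\<close>

text \<open>With u = -2x, the bound |ln (1 + u) - u| \<le> 2 u^2 is available for |u| \<le> 1/2,
  which is the assumed range; halving it gives the exponent.\<close>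

lemma inverse_sqrt_le_exp:
  fixes x :: real
  assumes "\<bar>x\<bar> \<le> 1/4"
  shows "1 / sqrt (1 - 2 * x) \<le> exp (x + 4 * x\<^sup>2)"
proof -
  have pos: "1 - 2 * x > 0" using assms by linarith
  have "\<bar>ln (1 + (- 2 * x)) - (- 2 * x)\<bar> \<le> 2 * (- 2 * x)\<^sup>2"
    using assms by (intro abs_ln_one_plus_x_minus_x_bound) auto
  then have "- (ln (1 - 2 * x) / 2) \<le> x + 4 * x\<^sup>2"
    by (simp add: power2_eq_square abs_le_iff)
  then have "exp (- (ln (1 - 2 * x) / 2)) \<le> exp (x + 4 * x\<^sup>2)"
    by (simp only: exp_le_cancel_iff)
  moreover have "1 / sqrt (1 - 2 * x) = exp (- (ln (1 - 2 * x) / 2))"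
  proof -
    have inv: "1 / exp z = exp (- z)" for z :: real
      by (simp add: exp_minus divide_inverse)
    have sq: "sqrt (1 - 2 * x) = exp (ln (1 - 2 * x) / 2)"
      using pos exp_ln[of "sqrt (1 - 2 * x)"] by (simp add: ln_sqrt)
    show ?thesis unfolding sq by (rule inv)
  qed
  ultimately show ?thesis by argo
qed

lemma prod_inverse_sqrt_le_exp:
  fixes x :: "'k \<Rightarrow> real"
  assumes "\<And>k. k \<in> A \<Longrightarrow> \<bar>x k\<bar> \<le> 1/4"
  shows "(\<Prod>k\<in>A. 1 / sqrt (1 - 2 * x k)) \<le> exp (\<Sum>k\<in>A. x k + 4 * (x k)\<^sup>2)"
proof (cases "finite A")
  case True
  have "0 \<le> 1 - 2 * x k" if "k \<in> A" for k using assms[OF that] by linarith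
  then show ?thesis
    using assms by (subst exp_sum[OF True]) (intro prod_mono conjI inverse_sqrt_le_exp, auto)
qed simp

lemma chernoff_bound:
  fixes Z :: "'a \<Rightarrow> real"
  assumes Z[measurable]: "Z \<in> borel_measurable M" and s: "s \<ge> 0"
    and mgf: "(\<integral>\<^sup>+w. ennreal (exp (s * Z w)) \<partial>M) \<le> ennreal (exp a)"
  shows "emeasure M {w \<in> space M. t \<le> Z w} \<le> ennreal (exp (a - s * t))"
proof -
  let ?A = "{w \<in> space M. t \<le> Z w}"
  have "emeasure M ?A = (\<integral>\<^sup>+w. indicator ?A w \<partial>M)" by simp
  also have "\<dots> \<le> (\<integral>\<^sup>+w. ennreal (exp (- (s * t))) * ennreal (exp (s * Z w)) \<partial>M)"
  proof (rule nn_integral_mono)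
    fix w
    have "1 \<le> exp (- (s * t)) * exp (s * Z w)" if "t \<le> Z w"
      using s that by (simp add: mult_left_mono flip: exp_add)
    then show "indicator ?A w \<le> ennreal (exp (- (s * t))) * ennreal (exp (s * Z w))"
      by (auto simp: indicator_def simp flip: ennreal_mult ennreal_1 intro!: ennreal_leI)
  qed
  also have "\<dots> = ennreal (exp (- (s * t))) * (\<integral>\<^sup>+w. ennreal (exp (s * Z w)) \<partial>M)"
    by (rule nn_integral_cmult) measurable
  also have "\<dots> \<le> ennreal (exp (- (s * t))) * ennreal (exp a)"
    by (intro mult_left_mono mgf) simp
  also have "\<dots> = ennreal (exp (a - s * t))"
    by (simp add: exp_diff exp_minus field_simps flip: ennreal_mult)
  finally show ?thesis .
qed

lemma chernoff_bound_abs: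
  fixes Z :: "'a \<Rightarrow> real"
  assumes M: "prob_space M" and Z[measurable]: "Z \<in> borel_measurable M" and s: "s \<ge> 0"
    and mgf: "\<And>\<sigma>. \<bar>\<sigma>\<bar> = s \<Longrightarrow> (\<integral>\<^sup>+w. ennreal (exp (\<sigma> * Z w)) \<partial>M) \<le> ennreal (exp a)"
  shows "measure M {w \<in> space M. t \<le> \<bar>Z w\<bar>} \<le> 2 * exp (a - s * t)"
proof -
  interpret prob_space M by fact
  have 1: "measure M {w \<in> space M. t \<le> Z w} \<le> exp (a - s * t)"
    using chernoff_bound[OF Z s mgf] s by (simp add: emeasure_eq_measure)
  have "emeasure M {w \<in> space M. t \<le> - Z w} \<le> ennreal (exp (a - s * t))"
    using mgf[of "-s"] s by (intro chernoff_bound) auto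
  then have 2: "measure M {w \<in> space M. t \<le> - Z w} \<le> exp (a - s * t)"
    by (simp add: emeasure_eq_measure)
  have "{w \<in> space M. t \<le> \<bar>Z w\<bar>} = {w \<in> space M. t \<le> Z w} \<union> {w \<in> space M. t \<le> - Z w}"
    by auto
  then have "measure M {w \<in> space M. t \<le> \<bar>Z w\<bar>}
      \<le> measure M {w \<in> space M. t \<le> Z w} + measure M {w \<in> space M. t \<le> - Z w}"
    by (simp add: measure_Un_le)
  with 1 2 show ?thesis by simp
qed

text \<open>The eigenbasis is a parameter and not a choice made from \<open>S\<close>: for the
  identity covariance every orthogonal \<open>U\<close> qualifies, so the basis can later be adapted
  to the other rows.\<close>

locale gaussian_rows =
  fixes U S :: "real^'d^'d" and lam :: "real^'d"
  assumes U: "orthogonal_matrix U" and S: "S = U ** diag_mat lam ** transpose U"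
    and pos: "\<And>k. lam $ k > 0"
begin

lemma prob_space_feature_space: "prob_space (feature_space S :: ('n::finite \<Rightarrow> real^'d) measure)"
  unfolding feature_space_def using prob_space_mvnormal[OF U S pos]
  by (intro prob_space_PiM)

lemma measurable_component: "(\<lambda>w. w i) \<in> feature_space S \<rightarrow>\<^sub>M borel"
  unfolding feature_space_def
  by (rule measurable_compose[OF measurable_component_singleton[OF UNIV_I]])
     (simp add: measurable_ident_sets sets_mvnormal)

lemma norm_sq_rotated: "x \<bullet> x = (\<Sum>k\<in>UNIV. ((transpose U *v x) $ k)\<^sup>2)"
proof -
  have "x \<bullet> x = x \<bullet> ((U ** diag_mat (\<chi> k. 1) ** transpose U) *v x)"
    using U by (simp add: diag_mat_one orthogonal_matrix_def del: transpose_matrix_vector)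
  then show ?thesis by (simp only: quadratic_form_orthogonal_diag) simp
qed

text \<open>The squared norm of a row is a sum of squares of independent centred normals with
  variances \<open>lam $ k\<close>. Its centring cancels the linear term of
  \<open>inverse_sqrt_le_exp\<close>, so only the quadratic terms survive.\<close>

lemma mgf_diag:
  assumes s: "\<And>k. \<bar>s\<bar> * lam $ k \<le> 1/4"
  shows "(\<integral>\<^sup>+w. ennreal (exp (s * (w i \<bullet> w i - (\<Sum>k\<in>UNIV. lam $ k))))
      \<partial>(feature_space S :: ('n::finite \<Rightarrow> real^'d) measure)) \<le> ennreal (exp (4 * s\<^sup>2 * (\<Sum>k\<in>UNIV. (lam $ k)\<^sup>2)))"
proof -
  interpret product_prob_space "\<lambda>_::'n. mvnormal S" UNIV
    using prob_space_mvnormal[OF U S pos] by (rule product_prob_spaceI)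
  have x: "\<bar>s * lam $ k\<bar> \<le> 1/4" for k
    using s[of k] pos[of k] by (simp add: abs_mult)
  let ?D = "\<Sum>k\<in>UNIV. lam $ k"
  have "(\<integral>\<^sup>+w. ennreal (exp (s * (w i \<bullet> w i - ?D))) \<partial>feature_space S)
     = (\<integral>\<^sup>+x. ennreal (exp (s * (x \<bullet> x - ?D))) \<partial>mvnormal S)"
    unfolding feature_space_def
    by (subst (2) PiM_component[of i, symmetric], simp, subst nn_integral_distr)
      (auto simp: measurable_cong_sets[OF sets_mvnormal refl])
  also have "\<dots> = (\<integral>\<^sup>+x. ennreal (exp (- (s * ?D))) * ennreal (exp (\<Sum>k\<in>UNIV. s * ((transpose U *v x) $ k)\<^sup>2)) \<partial>mvnormal S)"
    by (simp only: norm_sq_rotated right_diff_distrib exp_diff sum_distrib_left[symmetric])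
      (simp add: exp_minus field_simps flip: ennreal_mult)
  also have "\<dots> = ennreal (exp (- (s * ?D))) * ennreal (\<Prod>k\<in>UNIV. 1 / sqrt (1 - 2 * s * lam $ k))"
  proof (subst nn_integral_cmult)
    show "(\<lambda>x. ennreal (exp (\<Sum>k\<in>UNIV. s * ((transpose U *v x) $ k)\<^sup>2))) \<in> borel_measurable (mvnormal S)"
      unfolding measurable_cong_sets[OF sets_mvnormal refl] sum_distrib_left[symmetric] norm_sq_rotated[symmetric]
      by measurable
    show "ennreal (exp (- (s * ?D))) * (\<integral>\<^sup>+x. ennreal (exp (\<Sum>k\<in>UNIV. s * ((transpose U *v x) $ k)\<^sup>2)) \<partial>mvnormal S)
      = ennreal (exp (- (s * ?D))) * ennreal (\<Prod>k\<in>UNIV. 1 / sqrt (1 - 2 * s * lam $ k))"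
    proof -
      have "2 * s * lam $ k < 1" for k using x[of k] by (simp add: abs_le_iff)
      then show ?thesis by (simp only: nn_integral_mvnormal_exp_squares[OF U S pos])
    qed
  qed
  also have "\<dots> \<le> ennreal (exp (- (s * ?D))) * ennreal (exp (\<Sum>k\<in>UNIV. s * lam $ k + 4 * (s * lam $ k)\<^sup>2))"
    using prod_inverse_sqrt_le_exp[of UNIV "\<lambda>k. s * lam $ k"] x
    by (intro mult_left_mono ennreal_leI) (auto simp: mult.assoc)
  also have "\<dots> = ennreal (exp (4 * s\<^sup>2 * (\<Sum>k\<in>UNIV. (lam $ k)\<^sup>2)))"
    by (simp add: sum.distrib sum_distrib_left power_mult_distrib mult.assoc flip: ennreal_mult exp_add)
  finally show ?thesis .
qed

text \<open>Given row \<open>i\<close>, its product with row \<open>j\<close> is a centred Gaussian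
  with variance \<open>w i \<bullet> (S *v w i)\<close>. Integrating row \<open>j\<close> first
  therefore leaves the exponential of a weighted sum of squares in row \<open>i\<close>.\<close>

lemma mgf_off_diag:
  assumes s: "\<And>k. \<bar>s\<bar> * lam $ k \<le> 1/4" and ij: "i \<noteq> j"
  shows "(\<integral>\<^sup>+w. ennreal (exp (s * (w i \<bullet> w j)))
      \<partial>(feature_space S :: ('n::finite \<Rightarrow> real^'d) measure)) \<le> ennreal (exp (4 * s\<^sup>2 * (\<Sum>k\<in>UNIV. (lam $ k)\<^sup>2)))"
proof -
  interpret product_prob_space "\<lambda>_::'n. mvnormal S" UNIV
    using prob_space_mvnormal[OF U S pos] by (rule product_prob_spaceI)
  note [measurable] = measurable_component
  have y: "\<bar>s * lam $ k\<bar> \<le> 1/4" for k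
    using s[of k] pos[of k] by (simp add: abs_mult)
  have y2: "(s * lam $ k)\<^sup>2 \<le> 1/16" for k
    using power_mono[OF y[of k], of 2] by (simp add: power2_eq_square)
  \<comment> \<open>These are the weights, in rotated coordinates, of the exponent
    \<open>s\<^sup>2 * (w i \<bullet> (S *v w i)) / 2\<close> left by row \<open>j\<close>.\<close>
  define \<mu> where "\<mu> k = s\<^sup>2 * lam $ k / 2" for k
  have \<mu>: "\<mu> k * lam $ k = (s * lam $ k)\<^sup>2 / 2" for k
    by (simp add: \<mu>_def power2_eq_square)
  have "(\<integral>\<^sup>+w. ennreal (exp (s * (w i \<bullet> w j))) \<partial>feature_space S)
     = (\<integral>\<^sup>+w. \<integral>\<^sup>+x. ennreal (exp ((s *\<^sub>R w i) \<bullet> x)) \<partial>mvnormal S \<partial>feature_space S)"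
    unfolding feature_space_def
  proof (subst nn_integral_PiM_resample[OF prob_space_mvnormal[OF U S pos], of _ j])
    show "(\<lambda>w. ennreal (exp (s * (w i \<bullet> w j)))) \<in> borel_measurable (PiM UNIV (\<lambda>_. mvnormal S))"
      unfolding feature_space_def[symmetric] by measurable
  qed (use ij in simp)
  also have "\<dots> = (\<integral>\<^sup>+w. ennreal (exp (\<Sum>k\<in>UNIV. \<mu> k * ((transpose U *v w i) $ k)\<^sup>2)) \<partial>feature_space S)"
  proof (rule nn_integral_cong)
    fix w :: "'n \<Rightarrow> real^'d"
    have "(s *\<^sub>R w i) \<bullet> (S *v (s *\<^sub>R w i)) / 2 = s\<^sup>2 * (w i \<bullet> (S *v w i)) / 2"
      by (simp add: power2_eq_square matrix_vector_mult_scaleR)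
    also have "\<dots> = (\<Sum>k\<in>UNIV. \<mu> k * ((transpose U *v w i) $ k)\<^sup>2)"
      unfolding S quadratic_form_orthogonal_diag \<mu>_def
      by (simp add: sum_distrib_left sum_divide_distrib mult.assoc)
    finally have "exp ((s *\<^sub>R w i) \<bullet> (S *v (s *\<^sub>R w i)) / 2) = exp (\<Sum>k\<in>UNIV. \<mu> k * ((transpose U *v w i) $ k)\<^sup>2)"
      by (rule arg_cong)
    then show "(\<integral>\<^sup>+x. ennreal (exp ((s *\<^sub>R w i) \<bullet> x)) \<partial>mvnormal S)
       = ennreal (exp (\<Sum>k\<in>UNIV. \<mu> k * ((transpose U *v w i) $ k)\<^sup>2))"
      by (simp only: nn_integral_mvnormal_exp_inner[OF U S pos])
  qed
  also have "\<dots> = (\<integral>\<^sup>+x. ennreal (exp (\<Sum>k\<in>UNIV. \<mu> k * ((transpose U *v x) $ k)\<^sup>2)) \<partial>mvnormal S)"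
    unfolding feature_space_def
    by (subst (2) PiM_component[of i, symmetric], simp, subst nn_integral_distr)
      (auto simp: measurable_cong_sets[OF sets_mvnormal refl] simp del: transpose_matrix_vector
        intro!: borel_measurable_continuous_onI continuous_intros matrix_vector_mult_linear_continuous_on)
  also have "\<dots> = ennreal (\<Prod>k\<in>UNIV. 1 / sqrt (1 - 2 * \<mu> k * lam $ k))"
  proof -
    have "2 * \<mu> k * lam $ k < 1" for k
      using y2[of k] unfolding mult.assoc \<mu> by simp
    then show ?thesis by (rule nn_integral_mvnormal_exp_squares[OF U S pos])
  qed
  also have "\<dots> \<le> ennreal (exp (\<Sum>k\<in>UNIV. \<mu> k * lam $ k + 4 * (\<mu> k * lam $ k)\<^sup>2))"
  proof (intro ennreal_leI)
    have "\<bar>\<mu> k * lam $ k\<bar> \<le> 1/4" for k using y2[of k] unfolding \<mu> by simp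
    then show "(\<Prod>k\<in>UNIV. 1 / sqrt (1 - 2 * \<mu> k * lam $ k)) \<le> exp (\<Sum>k\<in>UNIV. \<mu> k * lam $ k + 4 * (\<mu> k * lam $ k)\<^sup>2)"
      unfolding mult.assoc by (rule prod_inverse_sqrt_le_exp)
  qed
  also have "\<dots> \<le> ennreal (exp (4 * s\<^sup>2 * (\<Sum>k\<in>UNIV. (lam $ k)\<^sup>2)))"
  proof -
    \<comment> \<open>With \<open>?q\<close> below 1 the left side is at most 3/2 of
      \<open>?q\<close>; the generous factor 4 lets diagonal and off-diagonal entries share one
      exponent.\<close>
    have "\<mu> k * lam $ k + 4 * (\<mu> k * lam $ k)\<^sup>2 \<le> 4 * s\<^sup>2 * (lam $ k)\<^sup>2" for k
    proof -
      let ?q = "(s * lam $ k)\<^sup>2"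
      have "?q * ?q \<le> ?q * 1" using y2[of k] by (intro mult_left_mono) auto
      then have "?q / 2 + 4 * (?q / 2)\<^sup>2 \<le> 4 * ?q"
        unfolding power2_eq_square[of "?q / 2"] using zero_le_power2[of "s * lam $ k"]
        by argo
      then show ?thesis unfolding \<mu> by (simp only: power_mult_distrib mult.assoc)
    qed
    then show ?thesis
      unfolding sum_distrib_left by (intro ennreal_leI) (simp add: sum_mono)
  qed
  finally show ?thesis .
qed

text \<open>The threshold \<open>t\<close> is tuned to the Chernoff exponent
  \<open>L - 4 * L\<close>, hence the cubic decay: there are n^2 entries, and the union bound over
  them should leave 2 / n.\<close>

lemma gram_entry_tail:
  fixes i j :: "'n::finite"
  assumes n: "CARD('n) \<ge> 2" and L: "L = ln (real CARD('n))"
    and t: "t = 8 * norm2 lam * sqrt L + 16 * norm_inf lam * L"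
  shows "measure (feature_space S :: ('n \<Rightarrow> real^'d) measure)
      {w \<in> space (feature_space S). t \<le> \<bar>w i \<bullet> w j - (if i = j then norm1 lam else 0)\<bar>}
    \<le> 2 / real CARD('n) ^ 3"
proof -
  note [measurable] = measurable_component
  let ?n = "real CARD('n)"
  have Lpos: "L > 0" using n by (simp add: L)
  let ?a = "norm2 lam" and ?b = "norm_inf lam"
  have lam_le: "lam $ k \<le> ?b" for k
  proof -
    have "\<bar>lam $ k\<bar> \<le> ?b" unfolding norm_inf_def by (rule Max_ge) auto
    then show ?thesis by simp
  qed
  have b: "?b > 0" using lam_le[of undefined] pos[of undefined] by linarith
  have a2: "(\<Sum>k\<in>UNIV. (lam $ k)\<^sup>2) = ?a\<^sup>2"
    by (simp add: norm2_def sum_nonneg)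
  have a: "?a \<ge> 0" by (simp add: norm2_def sum_nonneg)
  have D: "norm1 lam = (\<Sum>k\<in>UNIV. lam $ k)"
    using pos by (simp add: norm1_def less_imp_le)
  \<comment> \<open>\<open>s = 1 / r\<close> must be small in two ways, and each summand ensures one
    of them: the first makes \<open>4 * s\<^sup>2 * ?a\<^sup>2\<close> at most \<open>L\<close>, the
    second keeps \<open>s * lam $ k\<close> at most 1/4. The threshold is then
    \<open>4 * L * r\<close>.\<close>
  define r where "r = 2 * ?a / sqrt L + 4 * ?b"
  have r: "r > 0" unfolding r_def using a b Lpos by (intro add_nonneg_pos) auto
  define s where "s = 1 / r"
  have s: "s > 0" using r by (simp add: s_def)
  have s_lam: "s * lam $ k \<le> 1/4" for k
  proof -
    have "4 * lam $ k \<le> r" unfolding r_def using lam_le[of k] a Lpos by (simp add: add_increasing)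
    then show ?thesis using r by (simp add: s_def field_simps)
  qed
  have "s * ?a \<le> sqrt L / 2"
  proof -
    have "2 * ?a / sqrt L \<le> r" unfolding r_def using b by simp
    then have "2 * ?a \<le> r * sqrt L" using Lpos by (simp add: field_simps)
    then show ?thesis using r by (simp add: s_def field_simps)
  qed
  then have "(s * ?a)\<^sup>2 \<le> (sqrt L / 2)\<^sup>2"
    using s a by (intro power_mono) auto
  then have exponent: "4 * s\<^sup>2 * ?a\<^sup>2 \<le> L"
    using Lpos by (simp add: power_mult_distrib power_divide)
  have st: "s * t = 4 * L"
  proof -
    have "t = 4 * L * r"
      using Lpos real_sqrt_mult_self[of L] unfolding t r_def
      by (simp add: field_simps)
    then show ?thesis using r by (simp add: s_def)
  qed
  have "measure (feature_space S) {w \<in> space (feature_space S :: ('n \<Rightarrow> real^'d) measure).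
      t \<le> \<bar>w i \<bullet> w j - (if i = j then norm1 lam else 0)\<bar>} \<le> 2 * exp (L - s * t)"
  proof (rule chernoff_bound_abs[OF prob_space_feature_space])
    fix \<sigma> :: real assume \<sigma>: "\<bar>\<sigma>\<bar> = s"
    then have \<sigma>2: "\<sigma>\<^sup>2 = s\<^sup>2" by (metis power2_abs)
    have \<sigma>_lam: "\<bar>\<sigma>\<bar> * lam $ k \<le> 1/4" for k using s_lam \<sigma> by simp
    have "(\<integral>\<^sup>+w. ennreal (exp (\<sigma> * (w i \<bullet> w j - (if i = j then norm1 lam else 0))))
        \<partial>(feature_space S :: ('n \<Rightarrow> real^'d) measure)) \<le> ennreal (exp (4 * \<sigma>\<^sup>2 * (\<Sum>k\<in>UNIV. (lam $ k)\<^sup>2)))"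
    proof (cases "i = j")
      case True
      then show ?thesis using mgf_diag[of \<sigma> j, OF \<sigma>_lam] by (simp add: D)
    next
      case False
      then show ?thesis using mgf_off_diag[of \<sigma>, OF \<sigma>_lam False] by simp
    qed
    also have "\<dots> \<le> ennreal (exp L)"
      using exponent by (simp add: \<sigma>2 a2)
    finally show "(\<integral>\<^sup>+w. ennreal (exp (\<sigma> * (w i \<bullet> w j - (if i = j then norm1 lam else 0))))
        \<partial>(feature_space S :: ('n \<Rightarrow> real^'d) measure)) \<le> ennreal (exp L)" .
  qed (use s in simp_all)
  also have "2 * exp (L - s * t) = 2 / ?n ^ 3"
  proof -
    have "exp (L - s * t) = inverse (exp (3 * L))"
      by (simp add: st flip: exp_minus)
    also have "exp (3 * L) = exp L ^ 3" using exp_of_nat_mult[of 3 L] by simp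
    also have "exp L = ?n" using n by (simp add: L)
    finally show ?thesis by (simp add: divide_inverse)
  qed
  finally show ?thesis .
qed

text \<open>The exceptional event involves only Gram entries and no labels, so one event serves all
  \<open>Y\<close> at once.\<close>

lemma svm_interpolates_all_labels:
  assumes n: "CARD('n::finite) \<ge> 3"
    and D: "norm1 lam \<ge> 72 * (norm2 lam * real CARD('n) * sqrt (ln (real CARD('n)))
        + norm_inf lam * real CARD('n) * sqrt (real CARD('n)) * ln (real CARD('n)) + 1)"
  shows "\<exists>A \<in> sets (feature_space S :: ('n \<Rightarrow> real^'d) measure).
      measure (feature_space S) A \<ge> 1 - 2 / real CARD('n) \<and>
      (\<forall>w\<in>A. \<forall>Y :: real^'n. sign_labels Y \<longrightarrow> svm_interpolates (feature_matrix w) Y)"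
proof -
  note [measurable] = measurable_component
  let ?P = "feature_space S :: ('n \<Rightarrow> real^'d) measure"
  interpret prob_space ?P by (rule prob_space_feature_space)
  let ?n = "real CARD('n)"
  define L where "L = ln ?n"
  define t where "t = 8 * norm2 lam * sqrt L + 16 * norm_inf lam * L"
  define B where "B = (\<lambda>(i,j). {w \<in> space ?P. t \<le> \<bar>w i \<bullet> w j - (if i = j then norm1 lam else 0)\<bar>})"
  have Bm: "B p \<in> sets ?P" for p
    unfolding B_def by (cases p) simp
  have "measure ?P (\<Union>p\<in>UNIV. B p) \<le> (\<Sum>p\<in>UNIV. measure ?P (B p))"
    using Bm by (intro finite_measure_subadditive_finite) auto
  also have "\<dots> \<le> (\<Sum>p\<in>(UNIV :: ('n \<times> 'n) set). 2 / ?n ^ 3)"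
    using gram_entry_tail[OF _ L_def t_def] n by (intro sum_mono) (auto simp: B_def)
  also have "\<dots> = 2 / ?n"
    by (simp add: card_cartesian_product power3_eq_cube flip: UNIV_Times_UNIV)
  finally have bad: "measure ?P (\<Union>p\<in>UNIV. B p) \<le> 2 / ?n" .
  define A where "A = space ?P - (\<Union>p\<in>UNIV. B p)"
  have "measure ?P A = 1 - measure ?P (\<Union>p\<in>UNIV. B p)"
    unfolding A_def using Bm by (intro prob_compl) auto
  then have "measure ?P A \<ge> 1 - 2 / ?n" using bad by simp
  moreover have "A \<in> sets ?P" unfolding A_def using Bm by auto
  moreover have "svm_interpolates (feature_matrix w) Y" if w: "w \<in> A" and Y: "sign_labels Y" for w and Y :: "real^'n"
  proof -
    let ?X = "feature_matrix w"
    have a0: "norm2 lam \<ge> 0" by (simp add: norm2_def sum_nonneg)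
    have "\<bar>lam $ undefined\<bar> \<le> norm_inf lam" unfolding norm_inf_def by (rule Max_ge) auto
    then have b0: "norm_inf lam \<ge> 0" by linarith
    have L0: "L \<ge> 0" using n by (simp add: L_def)
    have n1: "sqrt ?n \<ge> 1" using n by simp
    have "norm_inf lam * ?n * 1 * L \<le> norm_inf lam * ?n * sqrt ?n * L"
      using b0 L0 n1 by (intro mult_right_mono mult_left_mono) auto
    moreover have "norm2 lam * ?n * sqrt L \<ge> 0" using a0 L0 by simp
    moreover have "norm_inf lam * ?n * 1 * L \<ge> 0" using b0 L0 by simp
    moreover have "?n * t = 8 * (norm2 lam * ?n * sqrt L) + 16 * (norm_inf lam * ?n * 1 * L)"
      by (simp add: t_def algebra_simps)
    \<comment> \<open>The arithmetic behind the constant 72: both 8 and 16 are below its half, and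
      \<open>q'\<close> exceeds \<open>q\<close> by the factor \<open>sqrt ?n\<close>. The summand 1
      gives strict positivity.\<close>
    moreover have "N \<le> d / 2" "0 < d"
      if "q \<le> q'" "0 \<le> p" "0 \<le> q" "N = 8 * p + 16 * q" "72 * (p + q' + 1) \<le> d" for N p q q' d :: real
      using that by argo+
    ultimately have nt: "?n * t \<le> norm1 lam / 2" and D0: "norm1 lam > 0"
      using D unfolding L_def[symmetric] by blast+
    have "\<exists>\<beta>. (?X ** transpose ?X) *v \<beta> = Y \<and> (\<forall>i. 0 \<le> Y $ i * \<beta> $ i)"
    proof (rule sign_pattern_of_near_scalar[OF D0 _ Y])
      fix i
      have entry: "(?X ** transpose ?X) $ i $ j = w i \<bullet> w j" for j
        by (simp add: matrix_matrix_mult_def transpose_def feature_matrix_def inner_vec_def)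
      have "(\<Sum>j\<in>UNIV. \<bar>(?X ** transpose ?X) $ i $ j - (if i = j then norm1 lam else 0)\<bar>) \<le> (\<Sum>j\<in>(UNIV::'n set). t)"
      proof (rule sum_mono)
        fix j
        have "w \<notin> B (i,j)" "w \<in> space ?P" using w unfolding A_def by auto
        then show "\<bar>(?X ** transpose ?X) $ i $ j - (if i = j then norm1 lam else 0)\<bar> \<le> t"
          unfolding entry B_def by auto
      qed
      also have "\<dots> = ?n * t" by simp
      finally show "(\<Sum>j\<in>UNIV. \<bar>(?X ** transpose ?X) $ i $ j - (if i = j then norm1 lam else 0)\<bar>) \<le> norm1 lam / 2"
        using nt by linarith
    qed
    then obtain \<beta> where "(?X ** transpose ?X) *v \<beta> = Y" "\<And>i. 0 \<le> Y $ i * \<beta> $ i" by blast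
    then show ?thesis
      using Y by (intro svm_interpolates_of_dual[of _ \<beta>]) (simp_all only: matrix_vector_mul_assoc)
  qed
  ultimately show ?thesis by blast
qed

end

section \<open>Isotropic features\<close>

text \<open>Multiplication by \<open>Q\<close> acts on every column by the same orthogonal map, and
  the inner product of two matrices is the sum of the inner products of their columns.\<close>

lemma matrix_mult_right_orthogonal:
  fixes Q :: "real^'n^'n"
  assumes Q: "orthogonal_matrix Q"
  shows "orthogonal_transformation (\<lambda>X :: real^'d^'n. Q ** X)"
proof -
  have "linear (\<lambda>X :: real^'d^'n. Q ** X)"
    by (intro linearI) (simp_all add: matrix_add_ldistrib,
      simp add: vec_eq_iff matrix_matrix_mult_def sum_distrib_left mult.left_commute)
  moreover have "(Q ** X) \<bullet> (Q ** Z) = X \<bullet> Z" for X Z :: "real^'d^'n"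
  proof -
    have cols: "A \<bullet> B = (\<Sum>c\<in>UNIV. column c A \<bullet> column c B)" for A B :: "real^'d^'n"
      by (simp add: inner_vec_def column_def) (rule sum.swap)
    have col: "column c (Q ** A) = Q *v column c A" for c and A :: "real^'d^'n"
      by (simp add: column_def matrix_matrix_mult_def matrix_vector_mult_def)
    have "(Q *v x) \<bullet> (Q *v y) = x \<bullet> y" for x y
      using Q orthogonal_transformation_matrix[of "(*v) Q"] by (simp add: orthogonal_transformation_def)
    then show ?thesis by (simp only: cols col)
  qed
  ultimately show ?thesis by (simp add: orthogonal_transformation_def)
qed

text \<open>This turns the joint law of the rows into a single density against product Lebesgue
  measure. It suffices to compare rectangles, on which the integral factors.\<close>

lemma PiM_density:
  fixes M :: "'a measure" and g :: "'a \<Rightarrow> ennreal"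
  assumes M: "sigma_finite_measure M" and g[measurable]: "g \<in> borel_measurable M"
    and gM: "sigma_finite_measure (density M g)"
  shows "PiM (UNIV :: 'n::finite set) (\<lambda>_. density M g)
    = density (PiM UNIV (\<lambda>_. M)) (\<lambda>w. \<Prod>i\<in>UNIV. g (w i))"
proof -
  interpret M: product_sigma_finite "\<lambda>_::'n. M" by (rule product_sigma_finite.intro) (rule M)
  interpret G: product_sigma_finite "\<lambda>_::'n. density M g" by (rule product_sigma_finite.intro) (rule gM)
  show ?thesis
  proof (rule G.PiM_eqI[symmetric])
    show "sets (density (PiM UNIV (\<lambda>_. M)) (\<lambda>w. \<Prod>i\<in>UNIV. g (w i))) = sets (PiM UNIV (\<lambda>_::'n. density M g))"
      by (simp cong: sets_PiM_cong)
    fix A :: "'n \<Rightarrow> 'a set" assume "\<And>i. i \<in> UNIV \<Longrightarrow> A i \<in> sets (density M g)"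
    then have A[measurable]: "A i \<in> sets M" for i by simp
    have "emeasure (density (PiM UNIV (\<lambda>_. M)) (\<lambda>w. \<Prod>i\<in>UNIV. g (w i))) (Pi\<^sub>E UNIV A)
       = (\<integral>\<^sup>+w. (\<Prod>i\<in>UNIV. g (w i)) * indicator (Pi\<^sub>E UNIV A) w \<partial>PiM UNIV (\<lambda>_. M))"
      by (rule emeasure_density) (auto intro!: sets_PiM_I_finite)
    also have "\<dots> = (\<integral>\<^sup>+w. (\<Prod>i\<in>UNIV. g (w i) * indicator (A i) (w i)) \<partial>PiM UNIV (\<lambda>_. M))"
    proof (rule nn_integral_cong)
      fix w :: "'n \<Rightarrow> 'a"
      have "(indicator (Pi\<^sub>E UNIV A) w :: ennreal) = (\<Prod>i\<in>UNIV. indicator (A i) (w i))"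
        by (auto simp: indicator_def PiE_def Pi_def)
      then show "(\<Prod>i\<in>UNIV. g (w i)) * indicator (Pi\<^sub>E UNIV A) w = (\<Prod>i\<in>UNIV. g (w i) * indicator (A i) (w i))"
        by (simp add: prod.distrib)
    qed
    also have "\<dots> = (\<Prod>i\<in>UNIV. \<integral>\<^sup>+x. g x * indicator (A i) x \<partial>M)"
      by (rule M.product_nn_integral_prod) auto
    also have "\<dots> = (\<Prod>i\<in>UNIV. emeasure (density M g) (A i))"
      by (simp add: emeasure_density)
    finally show "emeasure (density (PiM UNIV (\<lambda>_. M)) (\<lambda>w. \<Prod>i\<in>UNIV. g (w i))) (Pi\<^sub>E UNIV A)
      = (\<Prod>i\<in>UNIV. emeasure (density M g) (A i))" .
  qed simp
qed

section \<open>Rotation invariance of the isotropic feature law\<close>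

lemma gaussian_rows_identity:
  "orthogonal_matrix U \<Longrightarrow> gaussian_rows U (mat 1 :: real^'d^'d) (\<chi> k. 1)"
  by unfold_locales (simp_all add: diag_mat_one orthogonal_matrix_def del: transpose_matrix_vector)

lemma measurable_feature_matrix: "feature_matrix \<in> feature_space S \<rightarrow>\<^sub>M borel"
  unfolding feature_space_def feature_matrix_def
    measurable_cong_sets[OF sets_PiM_cong[OF refl sets_mvnormal] refl]
  by (rule borel_measurable_vec_lambda)

text \<open>The product of the row densities depends on the matrix only through
  \<open>X \<bullet> X\<close>, the sum of all squared entries; in this form the rotation invariance
  is visible.\<close>

lemma nn_integral_feature_matrix_identity:
  fixes F :: "real^'d^'n \<Rightarrow> ennreal"
  assumes F[measurable]: "F \<in> borel_measurable borel"
  shows "(\<integral>\<^sup>+w. F (feature_matrix w) \<partial>feature_space (mat 1))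
    = (\<integral>\<^sup>+X. ennreal (exp (- (X \<bullet> X) / 2) / sqrt ((2 * pi) ^ CARD('d)) ^ CARD('n)) * F X \<partial>lborel)"
proof -
  interpret gaussian_rows "mat 1" "mat 1 :: real^'d^'d" "\<chi> k. 1"
    by (rule gaussian_rows_identity[OF orthogonal_matrix_id])
  have one: "matrix_inv (mat 1 :: real^'d^'d) = mat 1"
    using matrix_inv_orthogonal_diag[OF U, of "\<chi> k. 1"] by (simp add: diag_mat_one)
  define g where "g = (\<lambda>x :: real^'d. ennreal (exp (- (x \<bullet> x) / 2) / sqrt ((2 * pi) ^ CARD('d))))"
  have [measurable]: "g \<in> borel_measurable borel" unfolding g_def by measurable
  have N: "mvnormal (mat 1 :: real^'d^'d) = density lborel g"
    by (simp add: mvnormal_def g_def one)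
  interpret N: prob_space "density lborel g"
    using prob_space_mvnormal[OF U S pos] by (simp add: N)
  have g: "(\<Prod>i\<in>UNIV. g (X $ i)) = ennreal (exp (- (X \<bullet> X) / 2) / sqrt ((2 * pi) ^ CARD('d)) ^ CARD('n))" for X :: "real^'d^'n"
    by (simp add: g_def prod_ennreal prod_dividef exp_sum[symmetric] sum_negf sum_divide_distrib inner_vec_def)
  have m: "(\<lambda>w. \<chi> i. w i) \<in> PiM (UNIV :: 'n set) (\<lambda>_. lborel :: (real^'d) measure) \<rightarrow>\<^sub>M borel"
    using borel_measurable_vec_lambda
    by (simp only: measurable_cong_sets[OF sets_PiM_cong[OF refl sets_lborel] refl])
  have mF: "(\<lambda>w. F (\<chi> i. w i)) \<in> borel_measurable (PiM (UNIV :: 'n set) (\<lambda>_. lborel :: (real^'d) measure))"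
    by (rule measurable_compose[OF m F])
  have "(\<integral>\<^sup>+w. F (feature_matrix w) \<partial>feature_space (mat 1))
     = (\<integral>\<^sup>+w. (\<Prod>i\<in>UNIV. g (w i)) * F (\<chi> i. w i) \<partial>PiM UNIV (\<lambda>_. lborel))"
    unfolding feature_space_def feature_matrix_def N
    by (subst PiM_density[OF _ _ N.sigma_finite_measure_axioms])
       (auto intro!: nn_integral_density mF sigma_finite_lborel)
  also have "\<dots> = (\<integral>\<^sup>+X. (\<Prod>i\<in>UNIV. g (X $ i)) * F X \<partial>distr (PiM UNIV (\<lambda>_. lborel)) borel (\<lambda>w. \<chi> i. w i))"
  proof -
    have [measurable]: "(\<lambda>X :: real^'d^'n. X $ i) \<in> borel_measurable borel" for i
      by (intro borel_measurable_continuous_onI continuous_intros)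
    have "(\<lambda>X. (\<Prod>i\<in>UNIV. g (X $ i)) * F X) \<in> borel_measurable borel" by measurable
    with nn_integral_distr[OF m, of "\<lambda>X. (\<Prod>i\<in>UNIV. g (X $ i)) * F X"] show ?thesis by simp
  qed
  finally show ?thesis by (simp only: g distr_PiM_lborel_vec)
qed

text \<open>Mixing the rows by an orthogonal \<open>Q\<close> preserves both
  \<open>X \<bullet> X\<close> and Lebesgue measure on matrices, hence the law.\<close>

lemma nn_integral_feature_matrix_rotate:
  fixes F :: "real^'d^'n \<Rightarrow> ennreal" and Q :: "real^'n^'n"
  assumes F[measurable]: "F \<in> borel_measurable borel" and Q: "orthogonal_matrix Q"
  shows "(\<integral>\<^sup>+w. F (Q ** feature_matrix w) \<partial>feature_space (mat 1)) = (\<integral>\<^sup>+w. F (feature_matrix w) \<partial>feature_space (mat 1))"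
proof -
  let ?f = "\<lambda>X :: real^'d^'n. Q ** X"
  have ot: "orthogonal_transformation ?f" by (rule matrix_mult_right_orthogonal[OF Q])
  have inner: "(Q ** X) \<bullet> (Q ** X) = X \<bullet> X" for X :: "real^'d^'n"
    using ot by (simp add: orthogonal_transformation_def)
  have m[measurable]: "?f \<in> borel_measurable borel"
    using orthogonal_transformation_linear[OF ot]
    by (intro borel_measurable_continuous_onI) (simp add: linear_continuous_on linear_conv_bounded_linear)
  define G where "G = (\<lambda>X :: real^'d^'n. ennreal (exp (- (X \<bullet> X) / 2) / sqrt ((2 * pi) ^ CARD('d)) ^ CARD('n)))"
  have G: "G (Q ** X) = G X" for X by (simp add: G_def inner)
  have [measurable]: "G \<in> borel_measurable borel" unfolding G_def by measurable
  have "(\<integral>\<^sup>+w. F (Q ** feature_matrix w) \<partial>feature_space (mat 1)) = (\<integral>\<^sup>+X. G X * F (Q ** X) \<partial>lborel)"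
    unfolding G_def by (rule nn_integral_feature_matrix_identity) measurable
  also have "\<dots> = (\<integral>\<^sup>+X. G (Q ** X) * F (Q ** X) \<partial>lborel)"
    by (simp only: G)
  also have "\<dots> = (\<integral>\<^sup>+X. G X * F X \<partial>lborel)"
    by (rule nn_integral_lborel_orthogonal[OF ot]) measurable
  finally show ?thesis unfolding nn_integral_feature_matrix_identity[OF F] G_def .
qed

text \<open>The reflection in the hyperplane orthogonal to \<open>a - b\<close> sends
  \<open>a\<close> to \<open>b\<close> because the norms agree. Since \<open>a - b\<close> vanishes
  at \<open>i\<close>, that coordinate stays untouched.\<close>

lemma householder_fixing_coordinate:
  fixes a b :: "real^'n"
  assumes ab: "norm a = norm b" and i: "a $ i = b $ i"
  obtains Q where "orthogonal_matrix Q" "Q *v a = b" "\<And>x. (Q *v x) $ i = x $ i"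
proof -
  define u where "u = a - b"
  \<comment> \<open>If \<open>a = b\<close>, the quotient has denominator 0, hence value 0, and
    \<open>f\<close> is the identity.\<close>
  define f where "f x = x - (2 * (u \<bullet> x) / (u \<bullet> u)) *\<^sub>R u" for x
  have lin: "linear f"
    by (intro linearI) (auto simp: f_def inner_add_right add_divide_distrib scaleR_add_left distrib_left scaleR_diff_right)
  have "f x \<bullet> f y = x \<bullet> y" for x y
  proof (cases "u = 0")
    case False
    then show ?thesis
      by (simp add: f_def inner_diff_left inner_diff_right inner_commute[of x u] field_simps)
  qed (simp add: f_def)
  then have ot: "orthogonal_transformation f"
    using lin by (simp add: orthogonal_transformation_def)
  have mat: "matrix f *v x = f x" for x
    using lin by (simp add: matrix_works linear_matrix_vector_mul_eq)
  have "f a = b"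
  proof (cases "u = 0")
    case False
    have "a \<bullet> a = b \<bullet> b" using ab by (simp add: norm_eq)
    then have "u \<bullet> u = 2 * (u \<bullet> a)"
      by (simp add: u_def inner_diff_left inner_diff_right inner_commute)
    moreover have "u \<bullet> u \<noteq> 0" using False by simp
    ultimately have "2 * (u \<bullet> a) / (u \<bullet> u) = 1" by simp
    then show ?thesis unfolding f_def by (simp only:) (simp add: u_def)
  qed (simp add: f_def u_def)
  moreover have "f x $ i = x $ i" for x
    using i by (simp add: f_def u_def)
  moreover have "orthogonal_matrix (matrix f)"
    using ot orthogonal_transformation_matrix by blast
  ultimately show thesis using that[of "matrix f"] by (simp add: mat)
qed

text \<open>Orthonormal bases of \<open>V\<close> and of its orthogonal complement have
  \<open>CARD('d)\<close> vectors together, so a bijection with the index type makes them the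
  columns of \<open>U\<close>; \<open>K\<close> collects the indices of the basis of
  \<open>V\<close>. Sums over \<open>K\<close> then compute with projections to
  \<open>V\<close>.\<close>

lemma adapted_orthonormal_basis:
  fixes V :: "(real^'d) set"
  assumes V: "subspace V"
  obtains U :: "real^'d^'d" and K where "orthogonal_matrix U" "card K = dim V"
    "\<And>k. k \<in> K \<Longrightarrow> column k U \<in> V" "\<And>k v. k \<notin> K \<Longrightarrow> v \<in> V \<Longrightarrow> (transpose U *v v) $ k = 0"
proof -
  let ?W = "{y \<in> UNIV. \<forall>x\<in>V. orthogonal x y}"
  have "dim ?W + dim V = dim (UNIV :: (real^'d) set)"
    using V by (intro dim_subspace_orthogonal_to_vectors) auto
  then have dims: "dim V + dim ?W = CARD('d)" by simp
  have W: "subspace ?W"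
    by (auto simp: subspace_def orthogonal_clauses)
  obtain B where B: "B \<subseteq> V" "pairwise orthogonal B" "\<And>x. x \<in> B \<Longrightarrow> norm x = 1"
      "independent B" "card B = dim V" "span B = V"
    by (rule orthonormal_basis_subspace[OF V]) blast
  obtain C where C: "C \<subseteq> ?W" "pairwise orthogonal C" "\<And>x. x \<in> C \<Longrightarrow> norm x = 1"
      "independent C" "card C = dim ?W" "span C = ?W"
    by (rule orthonormal_basis_subspace[OF W]) blast
  have fin: "finite B" "finite C"
    using B(4) C(4) by (auto simp: independent_imp_finite)
  have BC: "orthogonal x y" if "x \<in> B" "y \<in> C" for x y
    using that B(1) C(1) by auto
  have disj: "B \<inter> C = {}"
  proof (rule ccontr)
    assume "B \<inter> C \<noteq> {}"
    then obtain x where "x \<in> B" "x \<in> C" by auto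
    then have "orthogonal x x" "norm x = 1" using BC B(3) by auto
    then show False by (simp add: orthogonal_self)
  qed
  have "card (B \<union> C) = CARD('d)"
    using fin disj dims B(5) C(5) by (simp add: card_Un_disjoint)
  then obtain g where g: "bij_betw g (UNIV :: 'd set) (B \<union> C)"
    using finite_same_card_bij[of "UNIV :: 'd set" "B \<union> C"] fin by auto
  have gin: "g k \<in> B \<union> C" for k using g by (auto simp: bij_betw_def)
  have orth: "g k \<bullet> g l = (if k = l then 1 else 0)" for k l
  proof (cases "k = l")
    case True
    have "norm (g l) = 1" using gin[of l] B(3) C(3) by auto
    with True show ?thesis by (simp add: norm_eq_1)
  next
    case False
    then have "g k \<noteq> g l" using g by (auto simp: bij_betw_def inj_on_def)
    then have "orthogonal (g k) (g l)"
      using gin[of k] gin[of l] B(2) C(2) BC BC[THEN orthogonal_commute[THEN iffD1]]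
      by (auto simp: pairwise_def)
    with False show ?thesis by (simp add: orthogonal_def)
  qed
  define U where "U = (\<chi> i k. g k $ i)"
  have col: "column k U = g k" for k by (simp add: column_def U_def)
  have U: "(transpose U *v v) $ k = g k \<bullet> v" for v k
    by (simp add: U_def matrix_vector_mult_def transpose_def inner_vec_def del: transpose_matrix_vector)
  show thesis
  proof (rule that[of U "g -` B"])
    show "orthogonal_matrix U"
      unfolding orthogonal_matrix
      by (simp add: vec_eq_iff matrix_matrix_mult_def transpose_def U_def mat_def orth[unfolded inner_vec_def, simplified])
    have "card (g -` B) = card (g ` (g -` B))"
      using g by (intro card_image[symmetric]) (auto simp: bij_betw_def inj_on_def)
    also have "g ` (g -` B) = B"
      using g by (auto simp: bij_betw_def image_vimage_eq)
    finally show "card (g -` B) = dim V" using B by simp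
    show "column k U \<in> V" if "k \<in> g -` B" for k using that B(1) col by auto
    fix k v assume k: "k \<notin> g -` B" and v: "v \<in> V"
    then have "g k \<in> C" using gin[of k] by auto
    then show "(transpose U *v v) $ k = 0"
      using C(1) v unfolding U by (auto simp: orthogonal_def inner_commute)
  qed
qed

section \<open>Bad events for a fixed label vector: measurability and geometry\<close>

definition wrong_sign :: "'n::finite \<Rightarrow> real^'n \<Rightarrow> (real^'d^'n) set" where
  "wrong_sign i Y = {X. \<exists>\<beta>. (X ** transpose X) *v \<beta> = Y \<and> Y $ i * \<beta> $ i < 0}"

text \<open>The normalisation \<open>u $ i = 1\<close> is a closed condition, unlike
  \<open>u \<noteq> 0\<close>, so the set is a projection of a closed set.\<close>

definition dependent_row :: "'n::finite \<Rightarrow> (real^'d^'n) set" where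
  "dependent_row i = {X. \<exists>u. u $ i = 1 \<and> transpose X *v u = 0}"

text \<open>A closed set is a countable union of compact ones, and projections of compact sets are
  compact. Events described by an existential witness are thereby Borel.\<close>

lemma borel_exists_vec:
  fixes C :: "nat \<Rightarrow> ('a::euclidean_space \<times> 'b::euclidean_space) set"
  assumes "\<And>N. closed (C N)"
  shows "{x. \<exists>y N. (x, y) \<in> C N} \<in> sets borel"
proof -
  have "{x. \<exists>y N. (x, y) \<in> C N} = (\<Union>N. \<Union>M::nat. fst ` (C N \<inter> cball 0 (real M)))"
  proof (intro set_eqI iffI)
    fix x assume "x \<in> {x. \<exists>y N. (x, y) \<in> C N}"
    then obtain y N where "(x, y) \<in> C N" by auto
    moreover obtain M :: nat where "norm (x, y) \<le> M" using real_arch_simple by blast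
    ultimately have "x \<in> fst ` (C N \<inter> cball 0 (real M))" by (intro image_eqI[of _ _ "(x, y)"]) auto
    then show "x \<in> (\<Union>N. \<Union>M::nat. fst ` (C N \<inter> cball 0 (real M)))" by blast
  qed force
  moreover have "fst ` (C N \<inter> cball 0 (real M)) \<in> sets borel" for N M
    using assms by (intro borel_compact compact_continuous_image closed_Int_compact continuous_intros) auto
  ultimately show ?thesis by simp
qed

lemma continuous_on_transpose_mult_vec:
  "continuous_on A (\<lambda>p :: (real^'d^'n) \<times> (real^'n). transpose (fst p) *v snd p)"
  unfolding matrix_vector_mult_def transpose_def by (auto intro!: continuous_intros)

lemma continuous_on_gram_mult_vec:
  "continuous_on A (\<lambda>p :: (real^'d^'n) \<times> (real^'n). (fst p ** transpose (fst p)) *v snd p)"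
  unfolding matrix_vector_mult_def matrix_matrix_mult_def transpose_def by (auto intro!: continuous_intros)

lemma borel_wrong_sign: "wrong_sign i Y \<in> sets borel"
proof -
  \<comment> \<open>The strict sign condition is not closed, so it is exhausted by the margins
    \<open>1 / real (Suc N)\<close>.\<close>
  define C where "C = (\<lambda>N::nat. {p :: (real^'a^'b) \<times> (real^'b). (fst p ** transpose (fst p)) *v snd p = Y}
     \<inter> {p. Y $ i * snd p $ i \<le> - (1 / real (Suc N))})"
  have "closed (C N)" for N
    unfolding C_def
    by (intro closed_Int closed_Collect_eq closed_Collect_le continuous_on_gram_mult_vec continuous_intros)
  then have "{X. \<exists>\<beta> N. (X, \<beta>) \<in> C N} \<in> sets borel" by (rule borel_exists_vec)
  moreover have "Y $ i * \<beta> $ i < 0 \<longleftrightarrow> (\<exists>N. Y $ i * \<beta> $ i \<le> - (1 / real (Suc N)))" for \<beta> :: "real^'b"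
  proof
    assume "Y $ i * \<beta> $ i < 0"
    then obtain N where "inverse (real (Suc N)) < - (Y $ i * \<beta> $ i)"
      using reals_Archimedean[of "- (Y $ i * \<beta> $ i)"] by auto
    then show "\<exists>N. Y $ i * \<beta> $ i \<le> - (1 / real (Suc N))"
      by (intro exI[of _ N]) (simp add: inverse_eq_divide)
  next
    assume "\<exists>N. Y $ i * \<beta> $ i \<le> - (1 / real (Suc N))"
    then obtain N where "Y $ i * \<beta> $ i \<le> - (1 / real (Suc N))" by blast
    moreover have "1 / real (Suc N) > 0" by simp
    ultimately show "Y $ i * \<beta> $ i < 0" by linarith
  qed
  ultimately show ?thesis by (simp add: wrong_sign_def C_def)
qed

lemma borel_dependent_row: "dependent_row i \<in> sets borel"
proof -
  have "closed ({p :: (real^'a^'b) \<times> (real^'b). transpose (fst p) *v snd p = 0} \<inter> {p. snd p $ i = 1})"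
    by (intro closed_Int closed_Collect_eq continuous_on_transpose_mult_vec continuous_intros)
  from borel_exists_vec[OF this] show ?thesis
    by (simp add: dependent_row_def conj_commute del: transpose_matrix_vector)
qed

text \<open>A kernel vector of the Gram matrix is also killed by \<open>transpose X\<close>; scaled
  to have some coordinate equal to 1, it witnesses a dependent row. Hence a dual vector exists, and
  outside \<open>wrong_sign\<close> its signs are right.\<close>

lemma svm_interpolates_of_good:
  fixes X :: "real^'d^'n"
  assumes good: "\<And>i. X \<notin> wrong_sign i Y" "\<And>i. X \<notin> dependent_row i" and Y: "sign_labels Y"
  shows "svm_interpolates X Y"
proof -
  have "u = 0" if u: "(X ** transpose X) *v u = 0" for u
  proof -
    have "(transpose X *v u) \<bullet> (transpose X *v u) = u \<bullet> ((X ** transpose X) *v u)"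
      by (simp only: inner_transpose_mult_vec matrix_vector_mul_assoc)
    then have Xu: "transpose X *v u = 0" using u by (simp only: inner_zero_right inner_eq_zero_iff)
    show "u = 0"
    proof (rule ccontr)
      assume "u \<noteq> 0"
      then obtain i where i: "u $ i \<noteq> 0" by (auto simp: vec_eq_iff)
      have "transpose X *v ((1 / u $ i) *\<^sub>R u) = 0"
        by (simp only: matrix_vector_mult_scaleR Xu scaleR_zero_right)
      moreover have "((1 / u $ i) *\<^sub>R u) $ i = 1" using i by simp
      ultimately have "X \<in> dependent_row i" unfolding dependent_row_def by blast
      then show False using good by blast
    qed
  qed
  then obtain \<beta> where \<beta>: "(X ** transpose X) *v \<beta> = Y" using surj_matrix_of_inj by blast
  have "0 \<le> Y $ i * \<beta> $ i" for i
    using good(1)[of i] \<beta> unfolding wrong_sign_def by (auto simp: not_less)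
  then show ?thesis
    using \<beta> Y by (intro svm_interpolates_of_dual[of _ \<beta>]) (simp_all only: matrix_vector_mul_assoc)
qed

text \<open>The Gram matrix is conjugated by \<open>Q\<close>, so \<open>Q *v \<beta>\<close> solves
  the dual system of the rotated labels, and coordinate \<open>i\<close> of both vectors is
  unchanged.\<close>

lemma wrong_sign_rotate:
  fixes X :: "real^'d^'n"
  assumes Q: "orthogonal_matrix Q" and fix_i: "\<And>x. (Q *v x) $ i = x $ i" and X: "X \<in> wrong_sign i Y"
  shows "Q ** X \<in> wrong_sign i (Q *v Y)"
proof -
  obtain \<beta> where \<beta>: "(X ** transpose X) *v \<beta> = Y" "Y $ i * \<beta> $ i < 0"
    using X by (auto simp: wrong_sign_def)
  have QQ: "transpose Q ** Q = mat 1" using Q by (simp add: orthogonal_matrix)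
  have "((Q ** X) ** transpose (Q ** X)) *v (Q *v \<beta>) = (Q ** (X ** transpose X) ** (transpose Q ** Q)) *v \<beta>"
    by (simp only: matrix_transpose_mul matrix_vector_mul_assoc matrix_mul_assoc)
  also have "\<dots> = Q *v Y"
    unfolding QQ matrix_mul_rid \<beta>(1)[symmetric] matrix_vector_mul_assoc ..
  finally show ?thesis
    using \<beta>(2) fix_i unfolding wrong_sign_def by auto
qed

text \<open>\<open>K\<close> indexes an orthonormal basis (columns of \<open>U\<close>) of the orthogonal complement of the rows
  other than \<open>i\<close> and \<open>j\<close>, so sums over \<open>K\<close> are inner products of projections to it.\<close>

lemma wrong_sign_projection:
  fixes X :: "real^'d^'n" and U :: "real^'d^'d"
  assumes X: "X \<in> wrong_sign i Y" and e: "Y $ i * Y $ i = 1"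
    and Y0: "\<And>k. k \<noteq> i \<Longrightarrow> k \<noteq> j \<Longrightarrow> Y $ k = 0" and ij: "i \<noteq> j"
    and U: "orthogonal_matrix U"
    and V: "V = {v. \<forall>k. k \<noteq> i \<longrightarrow> k \<noteq> j \<longrightarrow> X $ k \<bullet> v = 0}"
    and K1: "\<And>k. k \<in> K \<Longrightarrow> column k U \<in> V"
    and K2: "\<And>k v. k \<notin> K \<Longrightarrow> v \<in> V \<Longrightarrow> (transpose U *v v) $ k = 0"
  shows "(\<Sum>k\<in>K. ((transpose U *v X $ j) $ k)\<^sup>2)
    \<le> Y $ i * Y $ j * (\<Sum>k\<in>K. (transpose U *v X $ i) $ k * (transpose U *v X $ j) $ k)"
proof -
  obtain \<beta> where \<beta>: "(X ** transpose X) *v \<beta> = Y" and neg: "Y $ i * \<beta> $ i < 0"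
    using X by (auto simp: wrong_sign_def)
  define a where "a = transpose X *v \<beta>"
  have Xa: "X $ k \<bullet> a = Y $ k" for k
  proof -
    have "(X *v a) $ k = Y $ k" unfolding a_def matrix_vector_mul_assoc \<beta> ..
    then show ?thesis by (simp add: matrix_vector_mult_def inner_vec_def)
  qed
  \<comment> \<open>The labels vanish outside \<open>i\<close> and \<open>j\<close>, so
    \<open>a\<close> is orthogonal to all other rows. Its coordinates outside \<open>K\<close> are
    then 0, and inner products with \<open>a\<close> become sums over \<open>K\<close>.\<close>
  have aV: "a \<in> V" using Xa Y0 by (auto simp: V)
  have a_sum: "a = (\<Sum>l\<in>UNIV. \<beta> $ l *\<^sub>R X $ l)"
    by (simp add: a_def vec_eq_iff vector_matrix_mult_def mult.commute)
  have coord: "(transpose U *v v) $ k = column k U \<bullet> v" for v k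
    by (simp add: matrix_vector_mult_def transpose_def inner_vec_def column_def del: transpose_matrix_vector)
  let ?x = "\<lambda>k. (transpose U *v X $ i) $ k" and ?z = "\<lambda>k. (transpose U *v X $ j) $ k"
    and ?a = "\<lambda>k. (transpose U *v a) $ k"
  have aK: "?a k = \<beta> $ i * ?x k + \<beta> $ j * ?z k" if k: "k \<in> K" for k
  proof -
    have "X $ l \<bullet> column k U = 0" if "l \<noteq> i" "l \<noteq> j" for l
      using K1[OF k] that by (auto simp: V)
    then have "?a k = (\<Sum>l\<in>{i,j}. \<beta> $ l * (column k U \<bullet> X $ l))"
      unfolding coord a_sum inner_sum_right inner_scaleR_right
      by (intro sum.mono_neutral_right) (auto simp: inner_commute)
    then show ?thesis using ij unfolding coord by simp
  qed
  have inner: "v \<bullet> a = (\<Sum>k\<in>K. (transpose U *v v) $ k * ?a k)" for v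
  proof -
    have UU: "U ** transpose U = mat 1" using U by (simp add: orthogonal_matrix_def)
    have "(transpose U *v v) \<bullet> (transpose U *v a) = v \<bullet> a"
      unfolding inner_transpose_mult_vec matrix_vector_mul_assoc UU by simp
    moreover have "(transpose U *v v) \<bullet> (transpose U *v a) = (\<Sum>k\<in>K. (transpose U *v v) $ k * ?a k)"
      unfolding inner_vec_def inner_real_def
      by (rule sum.mono_neutral_right) (use K2[OF _ aV] in \<open>auto simp del: transpose_matrix_vector\<close>)
    ultimately show ?thesis by simp
  qed
  \<comment> \<open>These are the Gram entries of rows \<open>i\<close> and \<open>j\<close>
    projected to \<open>V\<close>; \<open>eq1\<close> and \<open>eq2\<close> form the dual system
    reduced to two unknowns.\<close>
  define r c q where "r = (\<Sum>k\<in>K. (?x k)\<^sup>2)" and "c = (\<Sum>k\<in>K. ?x k * ?z k)" and "q = (\<Sum>k\<in>K. (?z k)\<^sup>2)"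
  have "Y $ i = (\<Sum>k\<in>K. ?x k * (\<beta> $ i * ?x k + \<beta> $ j * ?z k))"
    unfolding Xa[symmetric] inner by (intro sum.cong refl) (simp only: aK)
  then have eq1: "Y $ i = \<beta> $ i * r + \<beta> $ j * c"
    unfolding r_def c_def by (simp add: sum.distrib sum_distrib_left algebra_simps power2_eq_square del: transpose_matrix_vector)
  have "Y $ j = (\<Sum>k\<in>K. ?z k * (\<beta> $ i * ?x k + \<beta> $ j * ?z k))"
    unfolding Xa[symmetric] inner by (intro sum.cong refl) (simp only: aK)
  then have eq2: "Y $ j = \<beta> $ i * c + \<beta> $ j * q"
    unfolding q_def c_def by (simp add: sum.distrib sum_distrib_left algebra_simps power2_eq_square del: transpose_matrix_vector)
  have cs: "c\<^sup>2 \<le> r * q"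
    unfolding r_def c_def q_def by (rule Cauchy_Schwarz_ineq_sum)
  \<comment> \<open>Cramer's rule eliminates \<open>\<beta> $ j\<close>; the determinant
    \<open>r * q - c\<^sup>2\<close> is nonnegative by Cauchy-Schwarz.\<close>
  have "Y $ i * (Y $ i * q - Y $ j * c) = (Y $ i * \<beta> $ i) * (r * q - c\<^sup>2)"
    unfolding eq2 by (subst (2) eq1) (simp add: algebra_simps power2_eq_square)
  also have "\<dots> \<le> 0"
    by (rule mult_nonpos_nonneg) (use neg cs in auto)
  finally have "(Y $ i * Y $ i) * q \<le> Y $ i * Y $ j * c"
    by (simp add: algebra_simps)
  then show ?thesis by (simp only: e q_def c_def mult_1)
qed

section \<open>Probabilities of the bad events\<close>

lemma nn_integral_PiM_le_const:
  fixes f :: "('n::finite \<Rightarrow> 'a) \<Rightarrow> ennreal"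
  assumes N: "prob_space N" and le: "\<And>w. f w \<le> c"
  shows "(\<integral>\<^sup>+w. f w \<partial>PiM UNIV (\<lambda>_. N)) \<le> c"
proof -
  interpret prob_space "PiM (UNIV :: 'n set) (\<lambda>_. N)" using N by (intro prob_space_PiM)
  have "(\<integral>\<^sup>+w. f w \<partial>PiM UNIV (\<lambda>_. N)) \<le> (\<integral>\<^sup>+w. c \<partial>PiM (UNIV :: 'n set) (\<lambda>_. N))"
    by (intro nn_integral_mono le)
  also have "\<dots> = c" by (simp add: emeasure_space_1)
  finally show ?thesis .
qed

lemma measurable_indicator_feature_matrix:
  "B \<in> sets borel \<Longrightarrow> (\<lambda>w. indicator B (feature_matrix w) :: ennreal) \<in> borel_measurable (feature_space S)"
  by (rule measurable_compose[OF measurable_feature_matrix borel_measurable_indicator])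

lemma prob_space_mvnormal_identity: "prob_space (mvnormal (mat 1 :: real^'d^'d))"
proof -
  interpret gaussian_rows "mat 1" "mat 1 :: real^'d^'d" "\<chi> k. 1"
    by (rule gaussian_rows_identity[OF orthogonal_matrix_id])
  show ?thesis by (rule prob_space_mvnormal[OF U S pos])
qed

lemma expectation_exp_projection:
  fixes U :: "real^'d^'d"
  assumes U: "orthogonal_matrix U" and m: "m > 0"
  shows "(\<integral>\<^sup>+z. ennreal (exp (- (\<Sum>k\<in>K. ((transpose U *v z) $ k)\<^sup>2) / (2 * m))) \<partial>mvnormal (mat 1))
    = ennreal ((1 / sqrt (1 + 1 / m)) ^ card K)"
proof -
  interpret gaussian_rows U "mat 1 :: real^'d^'d" "\<chi> k. 1"
    by (rule gaussian_rows_identity[OF U])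
  \<comment> \<open>Weight 0 outside \<open>K\<close> contributes a factor 1, so only
    \<open>card K\<close> factors remain.\<close>
  define \<mu> where "\<mu> k = (if k \<in> K then - 1 / (2 * m) else 0)" for k
  have "(\<Sum>k\<in>UNIV. \<mu> k * ((transpose U *v z) $ k)\<^sup>2) = - (\<Sum>k\<in>K. ((transpose U *v z) $ k)\<^sup>2) / (2 * m)" for z
  proof -
    have "(\<Sum>k\<in>UNIV. \<mu> k * ((transpose U *v z) $ k)\<^sup>2) = (\<Sum>k\<in>K. \<mu> k * ((transpose U *v z) $ k)\<^sup>2)"
      by (rule sum.mono_neutral_right) (auto simp: \<mu>_def)
    also have "\<dots> = - (\<Sum>k\<in>K. ((transpose U *v z) $ k)\<^sup>2) / (2 * m)"
      unfolding sum_negf[symmetric] sum_divide_distrib by (intro sum.cong) (auto simp: \<mu>_def)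
    finally show ?thesis .
  qed
  then have "(\<integral>\<^sup>+z. ennreal (exp (- (\<Sum>k\<in>K. ((transpose U *v z) $ k)\<^sup>2) / (2 * m))) \<partial>mvnormal (mat 1))
     = (\<integral>\<^sup>+z. ennreal (exp (\<Sum>k\<in>UNIV. \<mu> k * ((transpose U *v z) $ k)\<^sup>2)) \<partial>mvnormal (mat 1))"
    by (simp only:)
  also have "\<dots> = ennreal (\<Prod>k\<in>UNIV. 1 / sqrt (1 - 2 * \<mu> k * (\<chi> k. 1) $ k))"
  proof (rule nn_integral_mvnormal_exp_squares[OF U S pos])
    have "1 / m > 0" using m by simp
    then have "-1 < 1 / m" by linarith
    then show "2 * \<mu> k * (\<chi> k. 1) $ k < 1" for k by (simp add: \<mu>_def)
  qed
  also have "(\<Prod>k\<in>UNIV. 1 / sqrt (1 - 2 * \<mu> k * (\<chi> k. 1) $ k)) = (\<Prod>k\<in>K. 1 / sqrt (1 + 1 / m))"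
    by (intro prod.mono_neutral_cong_right) (auto simp: \<mu>_def)
  finally show ?thesis by simp
qed

text \<open>At most \<open>CARD('n) - 2\<close> independent constraints act, fewer if those rows are
  dependent, whence an inequality. Sums on both sides avoid truncated subtraction.\<close>

lemma dim_orthogonal_rows:
  fixes w :: "'n::finite \<Rightarrow> real^'d"
  assumes ij: "i \<noteq> j"
  shows "subspace {v. \<forall>k. k \<noteq> i \<longrightarrow> k \<noteq> j \<longrightarrow> w k \<bullet> v = 0}"
    and "CARD('d) + 2 \<le> dim {v. \<forall>k. k \<noteq> i \<longrightarrow> k \<noteq> j \<longrightarrow> w k \<bullet> v = 0} + CARD('n)"
proof -
  let ?V = "{v. \<forall>k. k \<noteq> i \<longrightarrow> k \<noteq> j \<longrightarrow> w k \<bullet> v = 0}"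
  show "subspace ?V" by (auto simp: subspace_def inner_add_right)
  let ?R = "w ` (UNIV - {i, j})"
  have V: "?V = {y \<in> UNIV. \<forall>x\<in>span ?R. orthogonal x y}"
  proof (intro set_eqI iffI)
    fix v assume "v \<in> ?V"
    then have "orthogonal v x" if "x \<in> ?R" for x using that by (auto simp: orthogonal_def inner_commute)
    then have "orthogonal v x" if "x \<in> span ?R" for x by (rule orthogonal_to_span[OF that])
    then show "v \<in> {y \<in> UNIV. \<forall>x\<in>span ?R. orthogonal x y}" by (auto simp: orthogonal_commute)
  next
    fix v assume "v \<in> {y \<in> UNIV. \<forall>x\<in>span ?R. orthogonal x y}"
    then show "v \<in> ?V" by (auto simp: orthogonal_def span_base)
  qed
  have "dim ?V + dim (span ?R) = dim (UNIV :: (real^'d) set)"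
    unfolding V by (intro dim_subspace_orthogonal_to_vectors) auto
  then have "dim ?V + dim ?R = CARD('d)" by simp
  moreover have "dim ?R \<le> card ?R" by (rule dim_le_card') simp
  moreover have "card ?R \<le> card (UNIV - {i, j})" by (rule card_image_le) simp
  moreover have "card (UNIV - {i, j}) + 2 = CARD('n)"
    using ij card_mono[of UNIV "{i, j}"] by (simp add: card_Diff_subset)
  ultimately show "CARD('d) + 2 \<le> dim ?V + CARD('n)" by linarith
qed

text \<open>With the other rows frozen, \<open>wrong_sign_projection\<close> bounds the indicator by
  an exponential whose exponent is linear in row \<open>i\<close>. Integrating row \<open>i\<close>
  leaves \<open>exp (- q z / (2 * m))\<close>, and integrating row \<open>j\<close> gives one factor
  per dimension of \<open>V\<close>.\<close>

lemma prob_wrong_sign_two_coordinates: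
  fixes Y :: "real^'n"
  assumes ij: "i \<noteq> j" and e: "Y $ i * Y $ i = 1" and m: "m > 0" "(Y $ j)\<^sup>2 = m"
    and Y0: "\<And>k. k \<noteq> i \<Longrightarrow> k \<noteq> j \<Longrightarrow> Y $ k = 0" and dn: "CARD('n) \<le> CARD('d)"
  shows "(\<integral>\<^sup>+w. indicator (wrong_sign i Y) (feature_matrix w) \<partial>feature_space (mat 1 :: real^'d^'d))
    \<le> ennreal ((1 / sqrt (1 + 1 / m)) ^ (CARD('d) + 2 - CARD('n)))"
proof -
  let ?N = "mvnormal (mat 1 :: real^'d^'d)"
  let ?f = "\<lambda>w :: 'n \<Rightarrow> real^'d. indicator (wrong_sign i Y) (feature_matrix w) :: ennreal"
  note N = prob_space_mvnormal_identity
  have f: "?f \<in> borel_measurable (PiM UNIV (\<lambda>_. ?N))"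
    using measurable_indicator_feature_matrix[OF borel_wrong_sign] unfolding feature_space_def .
  have "(\<integral>\<^sup>+w. ?f w \<partial>feature_space (mat 1))
     = (\<integral>\<^sup>+w. (\<integral>\<^sup>+y. ?f (w(i := y)) \<partial>?N) \<partial>PiM UNIV (\<lambda>_. ?N))"
    unfolding feature_space_def by (rule nn_integral_PiM_resample[OF N f])
  \<comment> \<open>Rows \<open>i\<close> and \<open>j\<close> are integrated innermost because the
    subspace \<open>V\<close> depends on neither.\<close>
  also have "\<dots> = (\<integral>\<^sup>+w. (\<integral>\<^sup>+z. (\<integral>\<^sup>+y. ?f (w(j := z, i := y)) \<partial>?N) \<partial>?N) \<partial>PiM UNIV (\<lambda>_. ?N))"
    by (rule nn_integral_PiM_resample[OF N measurable_resample[OF N f]])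
  also have "\<dots> \<le> ennreal ((1 / sqrt (1 + 1 / m)) ^ (CARD('d) + 2 - CARD('n)))"
  proof (rule nn_integral_PiM_le_const[OF N])
    fix w :: "'n \<Rightarrow> real^'d"
    define V where "V = {v. \<forall>k. k \<noteq> i \<longrightarrow> k \<noteq> j \<longrightarrow> w k \<bullet> v = 0}"
    obtain U K where U: "orthogonal_matrix U" and K: "card K = dim V"
      and K1: "\<And>k. k \<in> K \<Longrightarrow> column k U \<in> V" and K2: "\<And>k v. k \<notin> K \<Longrightarrow> v \<in> V \<Longrightarrow> (transpose U *v v) $ k = 0"
      using adapted_orthonormal_basis[OF dim_orthogonal_rows(1)[OF ij, of w]] unfolding V_def by blast
    interpret gaussian_rows U "mat 1 :: real^'d^'d" "\<chi> k. 1" by (rule gaussian_rows_identity[OF U])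
    define q where "q z = (\<Sum>k\<in>K. ((transpose U *v z) $ k)\<^sup>2)" for z
    \<comment> \<open>Division by \<open>m\<close> is the optimal exponential tilt: for given
      \<open>z\<close>, the form \<open>m * (p z \<bullet> y)\<close> has variance
      \<open>m * q z\<close> in \<open>y\<close>, and the tilt 1 / m minimises the resulting
      bound.\<close>
    define p where "p z = (Y $ i * Y $ j / m) *\<^sub>R (\<Sum>k\<in>K. (transpose U *v z) $ k *\<^sub>R column k U)" for z
    have coord: "(transpose U *v v) $ k = column k U \<bullet> v" for v k
      by (simp add: matrix_vector_mult_def transpose_def inner_vec_def column_def del: transpose_matrix_vector)
    have p_inner: "p z \<bullet> y = Y $ i * Y $ j / m * (\<Sum>k\<in>K. (transpose U *v y) $ k * (transpose U *v z) $ k)" for z y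
      by (simp add: p_def inner_sum_left coord mult.commute del: transpose_matrix_vector)
    have orth: "column k U \<bullet> column l U = (if k = l then 1 else 0)" for k l
    proof -
      have "(transpose U ** U) $ k $ l = mat 1 $ k $ l" using U by (simp add: orthogonal_matrix)
      then show ?thesis by (simp add: matrix_matrix_mult_def transpose_def mat_def column_def inner_vec_def)
    qed
    have p_norm: "p z \<bullet> p z = q z / m" for z
    proof -
      have "(transpose U *v p z) $ k = Y $ i * Y $ j / m * (transpose U *v z) $ k" if "k \<in> K" for k
      proof -
        have "(\<Sum>l\<in>K. (transpose U *v z) $ l * (if k = l then 1 else 0)) = (transpose U *v z) $ k"
          using that by (simp del: transpose_matrix_vector add: if_distrib[where f="\<lambda>x. _ * x"] cong: if_cong)
        then show ?thesis
          unfolding coord[of "p z" k] unfolding p_def inner_scaleR_right inner_sum_right orth by simp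
      qed
      then have "p z \<bullet> p z = (Y $ i * Y $ j / m) * (\<Sum>k\<in>K. (Y $ i * Y $ j / m) * (transpose U *v z) $ k * (transpose U *v z) $ k)"
        unfolding p_inner by simp
      also have "\<dots> = (Y $ i * Y $ j / m)\<^sup>2 * q z"
        by (simp add: q_def sum_distrib_left power2_eq_square mult.assoc del: transpose_matrix_vector)
      also have "(Y $ i * Y $ j / m)\<^sup>2 = 1 / m"
        using e m by (simp add: power_divide power_mult_distrib) (simp add: power2_eq_square)
      finally show ?thesis by simp
    qed
    have bound: "?f (w(j := z, i := y)) \<le> ennreal (exp (- q z / m)) * ennreal (exp (p z \<bullet> y))" for z y
    proof (cases "feature_matrix (w(j := z, i := y)) \<in> wrong_sign i Y")
      case True
      have "V = {v. \<forall>k. k \<noteq> i \<longrightarrow> k \<noteq> j \<longrightarrow> feature_matrix (w(j := z, i := y)) $ k \<bullet> v = 0}"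
        by (auto simp: V_def feature_matrix_def)
      from wrong_sign_projection[OF True e Y0 ij U this K1 K2]
      have "q z \<le> Y $ i * Y $ j * (\<Sum>k\<in>K. (transpose U *v y) $ k * (transpose U *v z) $ k)"
        using ij by (simp add: feature_matrix_def q_def del: transpose_matrix_vector)
      also have "\<dots> = m * (p z \<bullet> y)" using m by (simp add: p_inner del: transpose_matrix_vector)
      finally have "0 \<le> - q z / m + p z \<bullet> y" using m by (simp add: field_simps)
      then have "1 \<le> exp (- q z / m) * exp (p z \<bullet> y)" by (simp flip: exp_add)
      then show ?thesis using True by (simp flip: ennreal_mult ennreal_1)
    qed simp
    have "(\<integral>\<^sup>+y. ?f (w(j := z, i := y)) \<partial>?N) \<le> ennreal (exp (- q z / (2 * m)))" for z
    proof -
      have "(\<integral>\<^sup>+y. ?f (w(j := z, i := y)) \<partial>?N) \<le> (\<integral>\<^sup>+y. ennreal (exp (- q z / m)) * ennreal (exp (p z \<bullet> y)) \<partial>?N)"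
        by (intro nn_integral_mono bound)
      also have "\<dots> = ennreal (exp (- q z / m)) * (\<integral>\<^sup>+y. ennreal (exp (p z \<bullet> y)) \<partial>?N)"
        by (rule nn_integral_cmult) (simp add: measurable_cong_sets[OF sets_mvnormal refl])
      also have "\<dots> = ennreal (exp (- q z / m)) * ennreal (exp (q z / (2 * m)))"
        unfolding nn_integral_mvnormal_exp_inner[OF U S pos] by (simp add: p_norm mult.commute)
      also have "\<dots> = ennreal (exp (- q z / (2 * m)))"
        using m by (simp add: field_simps flip: ennreal_mult exp_add)
      finally show ?thesis .
    qed
    then have "(\<integral>\<^sup>+z. (\<integral>\<^sup>+y. ?f (w(j := z, i := y)) \<partial>?N) \<partial>?N) \<le> (\<integral>\<^sup>+z. ennreal (exp (- q z / (2 * m))) \<partial>?N)"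
      by (intro nn_integral_mono)
    also have "\<dots> = ennreal ((1 / sqrt (1 + 1 / m)) ^ card K)"
      unfolding q_def by (rule expectation_exp_projection[OF U m(1)])
    \<comment> \<open>The base is at most 1, so a lower bound on the dimension of \<open>V\<close>
      is the right direction.\<close>
    also have "\<dots> \<le> ennreal ((1 / sqrt (1 + 1 / m)) ^ (CARD('d) + 2 - CARD('n)))"
    proof (intro ennreal_leI power_decreasing)
      show "CARD('d) + 2 - CARD('n) \<le> card K"
        using dim_orthogonal_rows(2)[OF ij, of w] unfolding V_def[symmetric] K by linarith
      have "1 / m > 0" using m(1) by simp
      then have "1 \<le> sqrt (1 + 1 / m)" by simp
      moreover have "1 / x \<le> 1" if "1 \<le> x" for x :: real using that by simp
      ultimately show "1 / sqrt (1 + 1 / m) \<le> 1" by blast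
    qed (use m(1) in simp)
    finally show "(\<integral>\<^sup>+z. (\<integral>\<^sup>+y. ?f (w(j := z, i := y)) \<partial>?N) \<partial>?N)
       \<le> ennreal ((1 / sqrt (1 + 1 / m)) ^ (CARD('d) + 2 - CARD('n)))" .
  qed
  finally show ?thesis .
qed

text \<open>By rotation invariance \<open>Y\<close> may be replaced by a vector with the same entry
  at \<open>i\<close> and all its remaining length in one coordinate \<open>j\<close>; the
  two-coordinate bound applies with the square of that length.\<close>

lemma prob_wrong_sign:
  fixes Y :: "real^'n"
  assumes n: "CARD('n) \<ge> 2" and Y: "sign_labels Y" and dn: "CARD('n) \<le> CARD('d)"
  shows "(\<integral>\<^sup>+w. indicator (wrong_sign i Y) (feature_matrix w) \<partial>feature_space (mat 1 :: real^'d^'d))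
    \<le> ennreal ((1 / sqrt (1 + 1 / (real CARD('n) - 1))) ^ (CARD('d) + 2 - CARD('n)))"
proof -
  let ?m = "real CARD('n) - 1"
  have YY: "Y $ k * Y $ k = 1" for k
    using Y[unfolded sign_labels_def, rule_format, of k] by auto
  have "card (UNIV - {i}) \<noteq> 0" using n by (simp add: card_Diff_subset)
  then obtain j where ij: "i \<noteq> j" by (metis card.empty Diff_eq_empty_iff insertI1 subsetI singletonD)
  \<comment> \<open>The entry \<open>sqrt ?m\<close> makes both squared norms equal to
    \<open>CARD('n)\<close>.\<close>
  define Z :: "real^'n" where "Z = (\<chi> k. if k = i then Y $ i else if k = j then sqrt ?m else 0)"
  have "Y \<bullet> Y = Z \<bullet> Z"
  proof -
    have "Z \<bullet> Z = (\<Sum>k\<in>{i, j}. Z $ k * Z $ k)"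
      unfolding inner_vec_def inner_real_def by (rule sum.mono_neutral_right) (auto simp: Z_def)
    also have "\<dots> = real CARD('n)" using ij n by (simp add: Z_def YY)
    finally show ?thesis by (simp add: inner_vec_def YY)
  qed
  then have "norm Y = norm Z" by (simp add: norm_eq)
  moreover have "Y $ i = Z $ i" by (simp add: Z_def)
  ultimately obtain Q where Q: "orthogonal_matrix Q" "Q *v Y = Z" "\<And>x. (Q *v x) $ i = x $ i"
    using householder_fixing_coordinate by metis
  have "(\<integral>\<^sup>+w. indicator (wrong_sign i Y) (feature_matrix w) \<partial>feature_space (mat 1 :: real^'d^'d))
     \<le> (\<integral>\<^sup>+w. indicator (wrong_sign i Z) (Q ** feature_matrix w) \<partial>feature_space (mat 1 :: real^'d^'d))"
    using wrong_sign_rotate[OF Q(1,3), of _ Y] Q(2) by (intro nn_integral_mono) (auto simp: indicator_def)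
  also have "\<dots> = (\<integral>\<^sup>+w. indicator (wrong_sign i Z) (feature_matrix w) \<partial>feature_space (mat 1 :: real^'d^'d))"
    by (rule nn_integral_feature_matrix_rotate[OF _ Q(1)]) (intro borel_measurable_indicator borel_wrong_sign)
  also have "\<dots> \<le> ennreal ((1 / sqrt (1 + 1 / ?m)) ^ (CARD('d) + 2 - CARD('n)))"
    using n ij YY by (intro prob_wrong_sign_two_coordinates[of i j] dn) (auto simp: Z_def)
  finally show ?thesis .
qed

text \<open>Given the other rows, row \<open>i\<close> would have to lie in their span, which has
  dimension below \<open>CARD('d)\<close> and is therefore a null set.\<close>

lemma prob_dependent_row:
  assumes dn: "CARD('n) \<le> CARD('d)"
  shows "(\<integral>\<^sup>+w. indicator (dependent_row i) (feature_matrix w)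
    \<partial>(feature_space (mat 1 :: real^'d^'d) :: ('n::finite \<Rightarrow> real^'d) measure)) = 0"
proof -
  let ?N = "mvnormal (mat 1 :: real^'d^'d)"
  let ?f = "\<lambda>w :: 'n \<Rightarrow> real^'d. indicator (dependent_row i) (feature_matrix w) :: ennreal"
  note N = prob_space_mvnormal_identity
  have f: "?f \<in> borel_measurable (PiM UNIV (\<lambda>_. ?N))"
    using measurable_indicator_feature_matrix[OF borel_dependent_row] unfolding feature_space_def .
  have zero: "(\<integral>\<^sup>+y. ?f (w(i := y)) \<partial>?N) \<le> 0" for w
  proof -
    let ?R = "span (w ` (UNIV - {i}))"
    have "dim ?R \<le> card (w ` (UNIV - {i}))" unfolding dim_span by (rule dim_le_card') simp
    also have "\<dots> \<le> card (UNIV - {i})" by (rule card_image_le) simp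
    also have "\<dots> < CARD('n)" by (rule psubset_card_mono) auto
    also note dn
    finally have "negligible ?R" by (intro negligible_lowdim) simp
    moreover have R: "?R \<in> sets borel" by (intro borel_closed closed_subspace subspace_span)
    ultimately have "emeasure lborel ?R = 0"
      by (simp add: negligible_iff_emeasure0 emeasure_completion)
    then have "AE y in lborel. y \<notin> ?R" using R by (intro AE_not_in) (simp add: null_sets_def)
    then have AE: "AE y in ?N. y \<notin> ?R"
      by (rule AE_mvnormal)
    have "y \<in> ?R" if dep: "feature_matrix (w(i := y)) \<in> dependent_row i" for y
    proof -
      obtain u where u: "u $ i = 1" "transpose (feature_matrix (w(i := y))) *v u = 0"
        using dep by (auto simp: dependent_row_def simp del: transpose_matrix_vector)
      have "0 = (\<Sum>k\<in>UNIV. u $ k *\<^sub>R (w(i := y)) k)"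
        using u(2) by (simp add: vec_eq_iff vector_matrix_mult_def feature_matrix_def mult.commute)
      also have "\<dots> = y + (\<Sum>k\<in>UNIV - {i}. u $ k *\<^sub>R w k)"
        by (simp add: sum.remove[of UNIV i] u(1))
      finally have "y = (\<Sum>k\<in>UNIV - {i}. (- u $ k) *\<^sub>R w k)"
        by (simp add: sum_negf eq_neg_iff_add_eq_0)
      moreover have "(\<Sum>k\<in>UNIV - {i}. (- u $ k) *\<^sub>R w k) \<in> ?R"
        by (intro span_sum span_scale span_base) auto
      ultimately show ?thesis by simp
    qed
    then have "AE y in ?N. ?f (w(i := y)) = 0"
      using AE by (auto simp: indicator_def elim!: eventually_mono)
    then show ?thesis by (subst nn_integral_cong_AE[of _ "\<lambda>_. 0"]) auto
  qed
  have "(\<integral>\<^sup>+w. ?f w \<partial>feature_space (mat 1)) = (\<integral>\<^sup>+w. (\<integral>\<^sup>+y. ?f (w(i := y)) \<partial>?N) \<partial>PiM UNIV (\<lambda>_. ?N))"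
    unfolding feature_space_def by (rule nn_integral_PiM_resample[OF N f])
  also have "\<dots> \<le> 0" by (rule nn_integral_PiM_le_const[OF N zero])
  finally show ?thesis by simp
qed

text \<open>The base is the square root of 1 - 1/n, so the power is at most exp (- r / (2 n)) for
  the exponent \<open>r\<close> of the power. The hypothesis makes r / (2 n) exceed 5 ln n, and 2 ln
  n already gives the claim.\<close>

lemma tail_power_le:
  fixes n d :: nat
  assumes n: "n \<ge> 2" and d: "real d > 10 * real n * ln (real n) + real n - 1" and dn: "n \<le> d"
  shows "(1 / sqrt (1 + 1 / (real n - 1))) ^ (d + 2 - n) \<le> 2 / real n ^ 2"
proof -
  define r where "r = real (d + 2 - n)"
  have r: "r > 10 * real n * ln (real n)" using d dn by (simp add: r_def of_nat_diff)
  have r0: "r \<ge> 0" by (simp add: r_def)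
  have x: "1 + 1 / (real n - 1) = 1 / (1 - 1 / real n)" using n by (simp add: field_simps)
  have pos: "1 - 1 / real n > 0" using n by simp
  \<comment> \<open>This is ln x \<le> x - 1 at x = 1 - 1/n.\<close>
  have "1 / real n \<le> - ln (1 - 1 / real n)" using ln_le_minus_one[OF pos] by simp
  also have "\<dots> = ln (1 + 1 / (real n - 1))" unfolding x using pos by (simp add: ln_div)
  finally have ln1: "1 / real n \<le> ln (1 + 1 / (real n - 1))" .
  have xpos: "1 + 1 / (real n - 1) > 0" using n by (simp add: add_pos_pos)
  have L: "ln (real n) \<ge> 0" using n by simp
  have "10 * ln (real n) = 10 * real n * ln (real n) * (1 / real n)" using n by simp
  also have "\<dots> \<le> r * ln (1 + 1 / (real n - 1))" using r r0 ln1 by (intro mult_mono) auto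
  finally have key: "2 * ln (real n) \<le> r * ln (1 + 1 / (real n - 1)) / 2" using L by linarith
  have "1 / sqrt (1 + 1 / (real n - 1)) = exp (- (ln (1 + 1 / (real n - 1)) / 2))"
  proof -
    have inv: "1 / exp z = exp (- z)" for z :: real by (simp add: exp_minus divide_inverse)
    have sq: "sqrt (1 + 1 / (real n - 1)) = exp (ln (1 + 1 / (real n - 1)) / 2)"
      using xpos exp_ln[of "sqrt (1 + 1 / (real n - 1))"] by (simp add: ln_sqrt)
    show ?thesis unfolding sq by (rule inv)
  qed
  then have "(1 / sqrt (1 + 1 / (real n - 1))) ^ (d + 2 - n) = exp (- (r * ln (1 + 1 / (real n - 1)) / 2))"
    unfolding r_def by (simp only: exp_of_nat_mult[symmetric]) simp
  also have "\<dots> \<le> exp (- (2 * ln (real n)))" using key by simp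
  also have "\<dots> = 1 / real n ^ 2"
  proof -
    have "exp (2 * ln (real n)) = real n ^ 2" using exp_of_nat_mult[of 2 "ln (real n)"] n by simp
    then show ?thesis by (simp add: exp_minus divide_inverse)
  qed
  also have "\<dots> \<le> 2 / real n ^ 2" by (simp add: divide_right_mono)
  finally show ?thesis .
qed

text \<open>For fixed labels only n events enter the union bound, so 2 / n^2 for each suffices; the
  dependent rows join these events at no cost in probability.\<close>

lemma svm_interpolates_isotropic:
  fixes Y :: "real^'n"
  assumes n: "CARD('n) \<ge> 2" and dn: "CARD('n) \<le> CARD('d)"
    and d: "real CARD('d) > 10 * real CARD('n) * ln (real CARD('n)) + real CARD('n) - 1"
    and Y: "sign_labels Y"
  shows "\<exists>A \<in> sets (feature_space (mat 1 :: real^'d^'d) :: ('n \<Rightarrow> real^'d) measure).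
      measure (feature_space (mat 1 :: real^'d^'d)) A \<ge> 1 - 2 / real CARD('n) \<and>
      (\<forall>w\<in>A. svm_interpolates (feature_matrix w) Y)"
proof -
  let ?P = "feature_space (mat 1 :: real^'d^'d) :: ('n \<Rightarrow> real^'d) measure"
  let ?n = "real CARD('n)"
  interpret prob_space ?P
    unfolding feature_space_def by (intro prob_space_PiM prob_space_mvnormal_identity)
  define B where "B i = feature_matrix -` (wrong_sign i Y \<union> dependent_row i) \<inter> space ?P" for i
  have Bm: "B i \<in> sets ?P" for i
    unfolding B_def by (intro measurable_sets[OF measurable_feature_matrix] sets.Un borel_wrong_sign borel_dependent_row)
  have "measure ?P (B i) \<le> 2 / ?n ^ 2" for i
  proof -
    have "emeasure ?P (B i) = (\<integral>\<^sup>+w. indicator (B i) w \<partial>?P)" using Bm by simp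
    also have "\<dots> \<le> (\<integral>\<^sup>+w. indicator (wrong_sign i Y) (feature_matrix w) + indicator (dependent_row i) (feature_matrix w) \<partial>?P)"
      by (intro nn_integral_mono) (auto simp: B_def indicator_def)
    also have "\<dots> = (\<integral>\<^sup>+w. indicator (wrong_sign i Y) (feature_matrix w) \<partial>?P)
        + (\<integral>\<^sup>+w. indicator (dependent_row i) (feature_matrix w) \<partial>?P)"
      by (intro nn_integral_add measurable_indicator_feature_matrix borel_wrong_sign borel_dependent_row)
    also have "\<dots> \<le> ennreal ((1 / sqrt (1 + 1 / (?n - 1))) ^ (CARD('d) + 2 - CARD('n)))"
      using prob_wrong_sign[OF n Y dn, of i] by (simp only: prob_dependent_row[OF dn] add_0_right)
    also have "\<dots> \<le> ennreal (2 / ?n ^ 2)"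
      by (intro ennreal_leI tail_power_le n d dn)
    finally show ?thesis by (simp add: emeasure_eq_measure)
  qed
  then have B_le: "measure ?P (B i) \<le> 2 / ?n ^ 2" for i .
  have "measure ?P (\<Union>i\<in>UNIV. B i) \<le> (\<Sum>i\<in>UNIV. measure ?P (B i))"
    using Bm by (intro finite_measure_subadditive_finite) auto
  also have "\<dots> \<le> (\<Sum>i\<in>(UNIV :: 'n set). 2 / ?n ^ 2)" by (intro sum_mono B_le)
  also have "\<dots> = 2 / ?n" by (simp add: power2_eq_square)
  finally have "measure ?P (\<Union>i\<in>UNIV. B i) \<le> 2 / ?n" .
  moreover define A where "A = space ?P - (\<Union>i\<in>UNIV. B i)"
  moreover have "measure ?P A = 1 - measure ?P (\<Union>i\<in>UNIV. B i)"
    unfolding A_def using Bm by (intro prob_compl) auto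
  ultimately have "measure ?P A \<ge> 1 - 2 / ?n" by simp
  moreover have "A \<in> sets ?P" unfolding A_def using Bm by auto
  moreover have "svm_interpolates (feature_matrix w) Y" if "w \<in> A" for w
    using that Y by (intro svm_interpolates_of_good) (auto simp: A_def B_def)
  ultimately show ?thesis by blast
qed

section \<open>Both claims together, with sample sizes one and two apart\<close>

theorem theorem1:
  fixes S :: "real^'d^'d" and lam :: "real^'d"
  assumes dn: "CARD('d) \<ge> CARD('n::finite)"
    and pd: "pos_def_mat S"
    and ev: "eigenvalue_vector S lam"
    and lam_pos: "\<forall>i. lam $ i > 0"
  shows
   "(norm1 lam \<ge> 72 * (norm2 lam * real CARD('n) * sqrt (ln (real CARD('n)))
        + norm_inf lam * real CARD('n) * sqrt (real CARD('n)) * ln (real CARD('n)) + 1)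
     \<longrightarrow> (\<exists>A \<in> sets (feature_space S :: ('n \<Rightarrow> real^'d) measure).
            measure (feature_space S) A \<ge> 1 - 2 / real CARD('n) \<and>
            (\<forall>\<omega>\<in>A. \<forall>Y :: real^'n. sign_labels Y \<longrightarrow>
                 svm_interpolates (feature_matrix \<omega>) Y)))
  \<and> ((S = mat 1 \<and> real CARD('d) > 10 * real CARD('n) * ln (real CARD('n)) + real CARD('n) - 1)
     \<longrightarrow> (\<forall>Y :: real^'n. sign_labels Y \<longrightarrow>
          (\<exists>A \<in> sets (feature_space S :: ('n \<Rightarrow> real^'d) measure).
            measure (feature_space S) A \<ge> 1 - 2 / real CARD('n) \<and>
            (\<forall>\<omega>\<in>A. svm_interpolates (feature_matrix \<omega>) Y))))"
proof (cases "CARD('n) \<ge> 3")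
  case True
  obtain U where "orthogonal_matrix U" "S = U ** diag_mat lam ** transpose U"
    using ev by (auto simp: eigenvalue_vector_def)
  then interpret gaussian_rows U S lam
    using lam_pos by unfold_locales auto
  show ?thesis
    using svm_interpolates_all_labels[OF True] svm_interpolates_isotropic[OF _ dn] True by auto
next
  case False
  then have "CARD('n) = 1 \<or> CARD('n) = 2"
    using zero_less_card_finite[where 'a='n] by linarith
  \<comment> \<open>For at most two samples the required probability is not positive, so the empty
    event witnesses both claims.\<close>
  then have "1 - 2 / real CARD('n) \<le> measure (feature_space S :: ('n \<Rightarrow> real^'d) measure) {}"
    by auto
  then show ?thesis by (intro conjI impI allI bexI[of _ "{}"]) auto
qed

end
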